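(* Let $K$ be a field and let $\mathfrak F=\{f_i:i<\alpha\}$ be a well-ordered $K$-Pfaffian family of additive endomorphisms of $K$, and suppose that the structure $(K,+,\cdot,f:f\in\mathfrak F)$ is sufficiently saturated. For $A\subseteq K$ let $\langle A\rangle$ be the closure of $A$ under all functions $f\in\mathfrak F$. Assume that for all $A\subseteq K$ $$\mathrm{acl}(A)=\langle A\rangle^{alg}\cap K,$$ where $\mathrm{acl}$ is the model-theoretic algebraic closure in the structure $(K,+,\cdot,f:f\in\mathfrak F)$ and $^{alg}$ denotes field-theoretic algebraic closure. Then every endomorphism $\sigma$ of the field $K$ that is definable (with parameters) in $(K,+,\cdot,f:f\in\mathfrak F)$ satisfies an identity of the form $$\mathrm{Frob}^j\circ\sigma=\tau$$ for some integer $j\ge 0$, where $\tau$ is a (possibly empty) composition of endomorphisms associated to functions of $\mathfrak F$ and of the Frobenius; here $\mathrm{Frob}^0$ is the identity, and in characteristic $0$ one has $j=0$ and no Frobenius occurs in $\tau$.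
   Context: $K$-free: the family $\mathfrak F=\{f_i:i<\alpha\}$ is $K$-free if whenever $\sum_i\lambda_if_i=0$ with $\lambda_i\in K$ zero for all but finitely many $i$, then $\lambda_i=0$ for all $i<\alpha$. $K$-Pfaffian: for every $i<\alpha$ there are $a^i_{j,k}\in K$ ($j,k\le i$), all but finitely many equal to $0$, such that $f_i(xy)=\sum_{j,k\le i}a^i_{j,k}f_j(x)f_k(y)$ for all $x,y\in K$. Associated endomorphisms: if $\mathfrak F$ is $K$-free and $K$-Pfaffian, the coefficients $a^i_{j,k}$ are unique, and $\sigma_i(x)=\sum_{j\le i}a^i_{j,i}f_j(x)$ is a ring endomorphism of $K$, called the endomorphism associated to $f_i$. If $\mathfrak F$ is $K$-Pfaffian but not $K$-free, then the subfamily of those $f_i$ which are not in the $K$-linear span of $\{f_j:j<i\}$, with the induced order, is $K$-free, $K$-Pfaffian and has the same $K$-linear span as $\mathfrak F$; the associated endomorphisms of $\mathfrak F$ are then those of this subfamily. $\langle A\rangle^{alg}$ is the algebraic closure, inside an algebraic closure of $K$, of the subfield generated by $\langle A\rangle$. In characteristic $p>0$, $\mathrm{Frob}$ is the map $x\mapsto x^p$. Sufficiently saturated: $\kappa$-saturated for some $\kappa>|\mathfrak F|+\aleph_0$. *)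

theory Defs
  imports "HOL-Algebra.Algebraic_Closure_Type" "HOL-Algebra.Generated_Fields"
begin

unbundle cardinal_syntax

section \<open>Families of additive maps\<close>

text \<open>
  A well-ordered family is a map \<open>f\<close> on a set \<open>I\<close> of indices taken from a well-ordered type.
  The field \<open>K\<close> is the type \<open>'a\<close>. Values of \<open>f\<close> outside \<open>I\<close> are irrelevant.
\<close>

definition K_free :: "'i set \<Rightarrow> ('i \<Rightarrow> 'a::field \<Rightarrow> 'a) \<Rightarrow> bool" where
  "K_free I f \<longleftrightarrow>
     (\<forall>c S. finite S \<and> S \<subseteq> I \<and> (\<forall>x. (\<Sum>i\<in>S. c i * f i x) = 0) \<longrightarrow> (\<forall>i\<in>S. c i = 0))"

definition K_span :: "'i set \<Rightarrow> ('i \<Rightarrow> 'a::field \<Rightarrow> 'a) \<Rightarrow> ('a \<Rightarrow> 'a) set" where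
  "K_span J f = {g. \<exists>c S. finite S \<and> S \<subseteq> J \<and> g = (\<lambda>x. \<Sum>j\<in>S. c j * f j x)}"

definition pfaffian_coeffs ::
    "'i::wellorder set \<Rightarrow> ('i \<Rightarrow> 'a::field \<Rightarrow> 'a) \<Rightarrow> 'i \<Rightarrow> ('i \<Rightarrow> 'i \<Rightarrow> 'a) \<Rightarrow> bool" where
  "pfaffian_coeffs I f i a \<longleftrightarrow>
     finite {(j, k). a j k \<noteq> 0} \<and>
     (\<forall>j k. a j k \<noteq> 0 \<longrightarrow> j \<in> I \<and> k \<in> I \<and> j \<le> i \<and> k \<le> i) \<and>
     (\<forall>x y. f i (x * y) = (\<Sum>(j, k) | a j k \<noteq> 0. a j k * f j x * f k y))"

definition K_pfaffian :: "'i::wellorder set \<Rightarrow> ('i \<Rightarrow> 'a::field \<Rightarrow> 'a) \<Rightarrow> bool" where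
  "K_pfaffian I f \<longleftrightarrow> (\<forall>i\<in>I. \<exists>a. pfaffian_coeffs I f i a)"

definition independent_part ::
    "'i::wellorder set \<Rightarrow> ('i \<Rightarrow> 'a::field \<Rightarrow> 'a) \<Rightarrow> 'i set" where
  "independent_part I f = {i \<in> I. f i \<notin> K_span {j \<in> I. j < i} f}"

text \<open>
  The endomorphisms associated to a Pfaffian family that need not be free are those of its
  independent part. By \<open>K_free_iff_independent_part\<close> below, a free family is its own
  independent part, so no case distinction is needed.
\<close>

definition associated_endos ::
    "'i::wellorder set \<Rightarrow> ('i \<Rightarrow> 'a::field \<Rightarrow> 'a) \<Rightarrow> ('a \<Rightarrow> 'a) set" where
  "associated_endos I f =
     (let J = independent_part I f in
      {\<sigma>. \<exists>i\<in>J. \<exists>a. pfaffian_coeffs J f i a \<and> \<sigma> = (\<lambda>x. \<Sum>j | a j i \<noteq> 0. a j i * f j x)})"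

lemma K_free_iff_independent_part:
  fixes I :: "'i::wellorder set" and f :: "'i \<Rightarrow> 'a::field \<Rightarrow> 'a"
  shows "K_free I f \<longleftrightarrow> independent_part I f = I"
proof
  assume free: "K_free I f"
  have False if i: "i \<in> I" "f i \<in> K_span {j \<in> I. j < i} f" for i
  proof -
    obtain c S where S: "finite S" "S \<subseteq> {j \<in> I. j < i}" "f i = (\<lambda>x. \<Sum>j\<in>S. c j * f j x)"
      using i unfolding K_span_def by blast
    have notin: "i \<notin> S" using S by auto
    define d where "d = c(i := - 1)"
    have "(\<Sum>j\<in>insert i S. d j * f j x) = 0" for x
    proof -
      have "(\<Sum>j\<in>S. d j * f j x) = (\<Sum>j\<in>S. c j * f j x)"
        using notin by (intro sum.cong) (auto simp: d_def)
      also have "\<dots> = f i x" by (subst S(3)) (rule refl)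
      finally show ?thesis using S(1) notin by (simp add: d_def)
    qed
    moreover have "finite (insert i S)" "insert i S \<subseteq> I" using S i by auto
    ultimately have "\<forall>j\<in>insert i S. d j = 0"
      using free unfolding K_free_def by blast
    thus False by (simp add: d_def)
  qed
  thus "independent_part I f = I" unfolding independent_part_def by blast
next
  assume ind: "independent_part I f = I"
  show "K_free I f"
    unfolding K_free_def
  proof (intro allI impI, rule ccontr)
    fix c S
    assume A: "finite S \<and> S \<subseteq> I \<and> (\<forall>x. (\<Sum>i\<in>S. c i * f i x) = 0)"
      and nz: "\<not> (\<forall>i\<in>S. c i = 0)"
    define T where "T = {j \<in> S. c j \<noteq> 0}"
    have T: "finite T" "T \<noteq> {}" "T \<subseteq> I" using A nz by (auto simp: T_def)
    define i where "i = Max T"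
    have i: "i \<in> T" using T by (simp add: i_def)
    have ci: "c i \<noteq> 0" using i by (simp add: T_def)
    have "f i x = (\<Sum>j\<in>T - {i}. (- c j / c i) * f j x)" for x
    proof -
      have "0 = (\<Sum>j\<in>S. c j * f j x)" using A by simp
      also have "\<dots> = (\<Sum>j\<in>T. c j * f j x)"
        unfolding T_def using A by (intro sum.mono_neutral_right) auto
      also have "\<dots> = c i * f i x + (\<Sum>j\<in>T - {i}. c j * f j x)"
        using T i by (simp add: sum.remove)
      finally have "f i x = - (\<Sum>j\<in>T - {i}. c j * f j x) / c i"
        using ci by (simp add: field_simps eq_neg_iff_add_eq_0)
      thus ?thesis by (simp add: sum_negf sum_divide_distrib)
    qed
    moreover have "T - {i} \<subseteq> {j \<in> I. j < i}"
      using T by (auto simp: i_def order.strict_iff_order)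
    ultimately have "f i \<in> K_span {j \<in> I. j < i} f"
      unfolding K_span_def using T(1)
      by (intro CollectI exI[of _ "\<lambda>j. - c j / c i"] exI[of _ "T - {i}"]) auto
    moreover have "i \<in> independent_part I f" using i T ind by auto
    ultimately show False by (simp add: independent_part_def)
  qed
qed

section \<open>The structure \<open>(K, +, \<cdot>, f : f \<in> \<FF>)\<close>\<close>

text \<open>
  First-order formulas with parameters: \<open>Par c\<close> is a constant symbol naming \<open>c \<in> K\<close>, and
  \<open>Fn i\<close> is the unary function symbol for \<open>f i\<close>. The generated set functions collect the
  function symbols and the parameters that occur.
\<close>

datatype (trm_syms: 'i, trm_pars: 'a) trm =
    Var nat
  | Par 'a
  | Plus "('i, 'a) trm" "('i, 'a) trm"
  | Times "('i, 'a) trm" "('i, 'a) trm"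
  | Fn 'i "('i, 'a) trm"

datatype (fm_syms: 'i, fm_pars: 'a) fm =
    Eq "('i, 'a) trm" "('i, 'a) trm"
  | Neg "('i, 'a) fm"
  | Conj "('i, 'a) fm" "('i, 'a) fm"
  | Exi nat "('i, 'a) fm"

primrec trm_vars :: "('i, 'a) trm \<Rightarrow> nat set" where
  "trm_vars (Var n) = {n}"
| "trm_vars (Par c) = {}"
| "trm_vars (Plus s t) = trm_vars s \<union> trm_vars t"
| "trm_vars (Times s t) = trm_vars s \<union> trm_vars t"
| "trm_vars (Fn i t) = trm_vars t"

primrec free_vars :: "('i, 'a) fm \<Rightarrow> nat set" where
  "free_vars (Eq s t) = trm_vars s \<union> trm_vars t"
| "free_vars (Neg \<phi>) = free_vars \<phi>"
| "free_vars (Conj \<phi> \<psi>) = free_vars \<phi> \<union> free_vars \<psi>"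
| "free_vars (Exi n \<phi>) = free_vars \<phi> - {n}"

primrec trm_val :: "('i \<Rightarrow> 'a::field \<Rightarrow> 'a) \<Rightarrow> (nat \<Rightarrow> 'a) \<Rightarrow> ('i, 'a) trm \<Rightarrow> 'a" where
  "trm_val f v (Var n) = v n"
| "trm_val f v (Par c) = c"
| "trm_val f v (Plus s t) = trm_val f v s + trm_val f v t"
| "trm_val f v (Times s t) = trm_val f v s * trm_val f v t"
| "trm_val f v (Fn i t) = f i (trm_val f v t)"

primrec sat :: "('i \<Rightarrow> 'a::field \<Rightarrow> 'a) \<Rightarrow> (nat \<Rightarrow> 'a) \<Rightarrow> ('i, 'a) fm \<Rightarrow> bool" where
  "sat f v (Eq s t) \<longleftrightarrow> trm_val f v s = trm_val f v t"
| "sat f v (Neg \<phi>) \<longleftrightarrow> \<not> sat f v \<phi>"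
| "sat f v (Conj \<phi> \<psi>) \<longleftrightarrow> sat f v \<phi> \<and> sat f v \<psi>"
| "sat f v (Exi n \<phi>) \<longleftrightarrow> (\<exists>c. sat f (v(n := c)) \<phi>)"

text \<open>Formulas over \<open>A\<close> in the language of the family, in the free variables \<open>0, \<dots>, n - 1\<close>.\<close>

definition formulas :: "'i set \<Rightarrow> 'a set \<Rightarrow> nat \<Rightarrow> ('i, 'a) fm set" where
  "formulas I A n = {\<phi>. fm_syms \<phi> \<subseteq> I \<and> fm_pars \<phi> \<subseteq> A \<and> free_vars \<phi> \<subseteq> {..<n}}"

text \<open>
  For formulas in the single free variable \<open>0\<close> the constant valuation \<open>\<lambda>_. x\<close> just assigns
  \<open>x\<close> to it.
\<close>

definition acl :: "'i set \<Rightarrow> ('i \<Rightarrow> 'a::field \<Rightarrow> 'a) \<Rightarrow> 'a set \<Rightarrow> 'a set" where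
  "acl I f A = \<Union> {D. finite D \<and> (\<exists>\<phi>\<in>formulas I A 1. D = {x. sat f (\<lambda>_. x) \<phi>})}"

text \<open>A function is definable (with arbitrary parameters) if its graph is.\<close>

definition definable_fun :: "'i set \<Rightarrow> ('i \<Rightarrow> 'a::field \<Rightarrow> 'a) \<Rightarrow> ('a \<Rightarrow> 'a) \<Rightarrow> bool" where
  "definable_fun I f g \<longleftrightarrow> (\<exists>\<phi>\<in>formulas I UNIV 2. \<forall>v. sat f v \<phi> \<longleftrightarrow> v 1 = g (v 0))"

definition saturated :: "'k rel \<Rightarrow> 'i set \<Rightarrow> ('i \<Rightarrow> 'a::field \<Rightarrow> 'a) \<Rightarrow> bool" where
  "saturated \<kappa> I f \<longleftrightarrow>
     (\<forall>A \<Gamma>. |A| <o \<kappa> \<and> \<Gamma> \<subseteq> formulas I A 1 \<and>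
        (\<forall>\<Delta>. finite \<Delta> \<and> \<Delta> \<subseteq> \<Gamma> \<longrightarrow> (\<exists>x. \<forall>\<phi>\<in>\<Delta>. sat f (\<lambda>_. x) \<phi>)) \<longrightarrow>
        (\<exists>x. \<forall>\<phi>\<in>\<Gamma>. sat f (\<lambda>_. x) \<phi>))"

section \<open>Closure operators\<close>

inductive_set fun_closure :: "'i set \<Rightarrow> ('i \<Rightarrow> 'a \<Rightarrow> 'a) \<Rightarrow> 'a set \<Rightarrow> 'a set"
  for I :: "'i set" and f :: "'i \<Rightarrow> 'a \<Rightarrow> 'a" and A :: "'a set" where
  base: "x \<in> A \<Longrightarrow> x \<in> fun_closure I f A"
| step: "i \<in> I \<Longrightarrow> x \<in> fun_closure I f A \<Longrightarrow> f i x \<in> fun_closure I f A"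

definition field_alg_closure :: "'a::field set \<Rightarrow> 'a alg_closure set" where
  "field_alg_closure S =
     {z. \<exists>p. p \<noteq> 0 \<and> (\<forall>n. coeff p n \<in> generate_field ring_of_type_algebra S) \<and>
             poly (map_poly to_ac p) z = 0}"

section \<open>Field endomorphisms\<close>

definition field_endo :: "('a::field \<Rightarrow> 'a) \<Rightarrow> bool" where
  "field_endo \<sigma> \<longleftrightarrow> \<sigma> \<in> ring_hom ring_of_type_algebra ring_of_type_algebra"

text \<open>Only meaningful in positive characteristic.\<close>

definition Frob :: "'a::field \<Rightarrow> 'a" where
  "Frob x = x ^ CHAR('a)"

definition compositions :: "('a \<Rightarrow> 'a) set \<Rightarrow> ('a \<Rightarrow> 'a) set" where
  "compositions G = {foldr (\<circ>) gs id | gs. set gs \<subseteq> G}"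

end

theory Submission
  imports Defs "HOL-Library.Function_Algebras" "HOL-Algebra.Exponent"
begin

text \<open>
  Suppose \<open>K\<close> is infinite. By saturation and the hypothesis on \<open>acl\<close>, finitely many polynomial
  relations between \<open>\<sigma> x\<close> and finitely many words in the \<open>f i\<close> at \<open>x\<close>, all nontrivial in \<open>\<sigma> x\<close>,
  cover \<open>K\<close>. Polynomials of bounded degree form a finite-dimensional translation-invariant space,
  so \<open>K\<close> has finitely many irreducible components for them, and one nontrivial relation holds on a
  coset of an additive subgroup \<open>\<Gamma>\<close> of finite index (the stabilizer of a component). As in Artin's
  theorem on additive maps, repeated differencing turns it into a relation on \<open>\<Gamma>\<close> that is linear
  in the \<open>Frob ^^ j \<circ> \<sigma>\<close> and the \<open>Frob ^^ j \<circ> w\<close> with \<open>w\<close> a word; on all of \<open>K\<close> it then holds up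
  to an additive map with finite range.

  The Pfaffian condition says that \<open>y \<mapsto> f i (x * y) - \<tau> x * f i y\<close> is a combination of the
  \<open>f k\<close> with \<open>k < i\<close>, where \<open>\<tau>\<close> is the endomorphism associated to \<open>f i\<close>. Hence a
  finite sequence of operators \<open>g \<mapsto> (y \<mapsto> g (x * y) - \<tau> x * g y)\<close>, with \<open>\<tau>\<close> a composition of
  associated endomorphisms and Frobenius, sends each \<open>f i\<close>, and then each word, to a map with finite
  range. These operators act on \<open>Frob ^^ j \<circ> \<sigma>\<close> by scalars, so the linear relation forces
  \<open>Frob ^^ j \<circ> \<sigma>\<close> to be one of the \<open>\<tau>\<close>.

  If \<open>K\<close> is finite, a generator of its multiplicative group shows that \<open>\<sigma>\<close> is a power map, hence
  a power of Frobenius.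
\<close>

section \<open>Maps killed by twisted differences\<close>

text \<open>The multiplier \<open>x\<close> is arbitrary at every stage, independently of the
  earlier ones. The recursion ends at finite range rather than at zero, because a relation on a
  subgroup of finite index extends to the field only up to a map with finite range.\<close>

primrec kills :: "('a::field \<Rightarrow> 'a) list \<Rightarrow> ('a \<Rightarrow> 'a) \<Rightarrow> bool" where
  "kills [] g \<longleftrightarrow> finite (range g)"
| "kills (\<tau> # \<tau>s) g \<longleftrightarrow> (\<forall>x. kills \<tau>s (\<lambda>y. g (x * y) - \<tau> x * g y))"

definition annih :: "('a::field \<Rightarrow> 'a) set \<Rightarrow> ('a \<Rightarrow> 'a) set" where
  "annih C = {g. \<exists>\<tau>s. set \<tau>s \<subseteq> C \<and> kills \<tau>s g}"

lemma finite_range_binop: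
  assumes "finite (range g)" "finite (range h)"
  shows "finite (range (\<lambda>y. F (g y) (h y)))"
proof (rule finite_subset)
  show "range (\<lambda>y. F (g y) (h y)) \<subseteq> (\<lambda>(u, v). F u v) ` (range g \<times> range h)" by auto
  show "finite ((\<lambda>(u, v). F u v) ` (range g \<times> range h))" using assms by simp
qed

lemma finite_range_compose: "finite (range g) \<Longrightarrow> finite (range (\<lambda>y. F (g y)))"
  using finite_range_binop[of g g "\<lambda>u v. F u"] by simp

lemma finite_range_precompose: "finite (range g) \<Longrightarrow> finite (range (\<lambda>y. g (F y)))"
  by (rule finite_subset[of _ "range g"]) auto

lemma kills_add: "kills \<tau>s g \<Longrightarrow> kills \<tau>s h \<Longrightarrow> kills \<tau>s (\<lambda>y. g y + h y)"
proof (induction \<tau>s arbitrary: g h)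
  case (Cons \<tau> \<tau>s)
  show ?case unfolding kills.simps
  proof
    fix x
    have "kills \<tau>s (\<lambda>y. (g (x * y) - \<tau> x * g y) + (h (x * y) - \<tau> x * h y))"
      using Cons.prems by (intro Cons.IH) auto
    then show "kills \<tau>s (\<lambda>y. g (x * y) + h (x * y) - \<tau> x * (g y + h y))"
      by (simp add: algebra_simps)
  qed
qed (simp add: finite_range_binop)

lemma kills_scale: "kills \<tau>s g \<Longrightarrow> kills \<tau>s (\<lambda>y. c * g y)"
proof (induction \<tau>s arbitrary: g)
  case (Cons \<tau> \<tau>s)
  show ?case unfolding kills.simps
  proof
    fix x
    have "kills \<tau>s (\<lambda>y. c * (g (x * y) - \<tau> x * g y))"
      using Cons.prems by (intro Cons.IH) auto
    then show "kills \<tau>s (\<lambda>y. c * g (x * y) - \<tau> x * (c * g y))"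
      by (simp add: algebra_simps)
  qed
qed (simp add: finite_range_compose)

lemma kills_shift: "kills \<tau>s g \<Longrightarrow> kills \<tau>s (\<lambda>y. g (z * y))"
proof (induction \<tau>s arbitrary: g)
  case (Cons \<tau> \<tau>s)
  show ?case unfolding kills.simps
  proof
    fix x
    have "kills \<tau>s (\<lambda>y. g (x * y) - \<tau> x * g y)" using Cons.prems by auto
    from Cons.IH[OF this] show "kills \<tau>s (\<lambda>y. g (z * (x * y)) - \<tau> x * g (z * y))"
      by (simp add: algebra_simps)
  qed
qed (simp add: finite_range_precompose)

text \<open>Being killed by \<open>\<tau>s\<close> is stable under shifts and linear combinations,
  so one more difference in front does no harm, whatever \<tau> is. Concatenation thus yields a
  common list for several maps.\<close>

lemma kills_Cons: "kills \<tau>s g \<Longrightarrow> kills (\<tau> # \<tau>s) g"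
  using kills_add[OF kills_shift kills_scale[where c = "- \<tau> _"]] by fastforce

lemma kills_append1: "kills \<tau>s g \<Longrightarrow> kills (\<rho>s @ \<tau>s) g"
  by (induction \<rho>s) (auto simp del: kills.simps intro: kills_Cons)

lemma kills_append2: "kills \<tau>s g \<Longrightarrow> kills (\<tau>s @ \<rho>s) g"
proof (induction \<tau>s arbitrary: g)
  case Nil
  then show ?case using kills_append1[of "[]" g \<rho>s] by simp
qed simp

lemma annih_add: "g \<in> annih C \<Longrightarrow> h \<in> annih C \<Longrightarrow> (\<lambda>y. g y + h y) \<in> annih C"
proof -
  assume "g \<in> annih C" "h \<in> annih C"
  then obtain \<tau>s \<rho>s where "set \<tau>s \<subseteq> C" "kills \<tau>s g" "set \<rho>s \<subseteq> C" "kills \<rho>s h"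
    unfolding annih_def by blast
  then have "set (\<tau>s @ \<rho>s) \<subseteq> C \<and> kills (\<tau>s @ \<rho>s) (\<lambda>y. g y + h y)"
    by (auto intro: kills_add kills_append1 kills_append2)
  then show ?thesis unfolding annih_def by blast
qed

lemma annih_scale: "g \<in> annih C \<Longrightarrow> (\<lambda>y. c * g y) \<in> annih C"
  unfolding annih_def using kills_scale by blast

lemma annih_finite_range: "finite (range g) \<Longrightarrow> g \<in> annih C"
  unfolding annih_def by (auto intro: exI[of _ "[]"])

lemma annih_sum:
  assumes "finite S" "\<And>s. s \<in> S \<Longrightarrow> g s \<in> annih C"
  shows "(\<lambda>y. \<Sum>s\<in>S. c s * g s y) \<in> annih C"
  using assms
proof (induction S)
  case empty
  show ?case by (simp add: annih_finite_range)
next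
  case (insert s S)
  then have "(\<lambda>y. c s * g s y + (\<Sum>s\<in>S. c s * g s y)) \<in> annih C"
    by (intro annih_add annih_scale) auto
  then show ?case using insert by simp
qed

text \<open>Induction on the total length through the splitting \<open>g (h (x * y)) - \<tau>
  (\<rho> x) * g (h y) = g (h (x * y) - \<rho> x * h y) + (g (\<rho> x * h y) - \<tau> (\<rho> x) *
  g (h y))\<close>. The first summand shortens \<open>\<rho>s\<close>; the second is a twisted
  difference of \<open>g\<close> composed with \<open>h\<close> and shortens
  \<open>\<tau>s\<close>.\<close>

lemma kills_comp:
  assumes "additive g" "kills \<tau>s g" "kills \<rho>s h"
    and "\<And>\<tau> \<rho>. \<tau> \<in> set \<tau>s \<Longrightarrow> \<rho> \<in> set \<rho>s \<Longrightarrow> (\<lambda>x. \<tau> (\<rho> x)) \<in> C"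
  shows "(\<lambda>y. g (h y)) \<in> annih C"
proof -
  \<comment> \<open>The list is chosen before \<open>g\<close> and \<open>h\<close>: the maps in the
    splitting depend on \<open>x\<close>, whereas \<open>kills\<close> asks for one list for all
    \<open>x\<close>.\<close>
  have "\<exists>L. set L \<subseteq> C \<and> (\<forall>g h. additive g \<and> kills \<tau>s g \<and> kills \<rho>s h \<longrightarrow> kills L (\<lambda>y. g (h y)))"
    using assms(4)
  proof (induction "length \<tau>s + length \<rho>s" arbitrary: \<tau>s \<rho>s rule: less_induct)
    case less
    consider "\<tau>s = []" | "\<rho>s = []" | \<tau> \<tau>s' \<rho> \<rho>s' where "\<tau>s = \<tau> # \<tau>s'" "\<rho>s = \<rho> # \<rho>s'"
      by (meson neq_Nil_conv)
    then show ?case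
    proof cases
      case 1
      then show ?thesis
        by (intro exI[of _ "[]"]) (auto intro: finite_range_precompose)
    next
      case 2
      then show ?thesis
        by (intro exI[of _ "[]"]) (auto intro: finite_range_compose)
    next
      case 3
      have "\<exists>L. set L \<subseteq> C \<and> (\<forall>g h. additive g \<and> kills \<tau>s g \<and> kills \<rho>s' h \<longrightarrow> kills L (\<lambda>y. g (h y)))"
        using 3 less.prems by (intro less.hyps) auto
      then obtain L1 where L1: "set L1 \<subseteq> C"
        "\<And>g h. additive g \<Longrightarrow> kills \<tau>s g \<Longrightarrow> kills \<rho>s' h \<Longrightarrow> kills L1 (\<lambda>y. g (h y))" by blast
      have "\<exists>L. set L \<subseteq> C \<and> (\<forall>g h. additive g \<and> kills \<tau>s' g \<and> kills \<rho>s h \<longrightarrow> kills L (\<lambda>y. g (h y)))"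
        using 3 less.prems by (intro less.hyps) auto
      then obtain L2 where L2: "set L2 \<subseteq> C"
        "\<And>g h. additive g \<Longrightarrow> kills \<tau>s' g \<Longrightarrow> kills \<rho>s h \<Longrightarrow> kills L2 (\<lambda>y. g (h y))" by blast
      show ?thesis
      proof (intro exI[of _ "(\<lambda>x. \<tau> (\<rho> x)) # (L1 @ L2)"] conjI allI impI)
        show "set ((\<lambda>x. \<tau> (\<rho> x)) # (L1 @ L2)) \<subseteq> C"
          using 3 less.prems L1 L2 by auto
        fix g h assume gh: "additive g \<and> kills \<tau>s g \<and> kills \<rho>s h"
        show "kills ((\<lambda>x. \<tau> (\<rho> x)) # (L1 @ L2)) (\<lambda>y. g (h y))"
          unfolding kills.simps
        proof
          fix x
          have k1: "kills L1 (\<lambda>y. g (h (x * y) - \<rho> x * h y))"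
            using gh 3 by (intro L1(2)) auto
          have "additive (\<lambda>y. g (\<rho> x * y) - \<tau> (\<rho> x) * g y)"
            using gh by (auto simp: additive_def algebra_simps)
          then have k2: "kills L2 (\<lambda>y. g (\<rho> x * h y) - \<tau> (\<rho> x) * g (h y))"
            using gh 3 by (intro L2(2)[of "\<lambda>y. g (\<rho> x * y) - \<tau> (\<rho> x) * g y"]) auto
          have "kills (L1 @ L2) (\<lambda>y. g (h (x * y) - \<rho> x * h y) + (g (\<rho> x * h y) - \<tau> (\<rho> x) * g (h y)))"
            by (rule kills_add[OF kills_append2[OF k1] kills_append1[OF k2]])
          moreover have "g (h (x * y) - \<rho> x * h y) = g (h (x * y)) - g (\<rho> x * h y)" for y
            using gh additive.diff by blast
          ultimately show "kills (L1 @ L2) (\<lambda>y. g (h (x * y)) - \<tau> (\<rho> x) * g (h y))"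
            by simp
        qed
      qed
    qed
  qed
  then show ?thesis using assms(1-3) unfolding annih_def by blast
qed

lemma annih_comp:
  assumes "additive g" "g \<in> annih C" "h \<in> annih C"
    and "\<And>\<tau> \<rho>. \<tau> \<in> C \<Longrightarrow> \<rho> \<in> C \<Longrightarrow> \<tau> \<circ> \<rho> \<in> C"
  shows "(\<lambda>y. g (h y)) \<in> annih C"
proof -
  obtain \<tau>s \<rho>s where *: "set \<tau>s \<subseteq> C" "kills \<tau>s g" "set \<rho>s \<subseteq> C" "kills \<rho>s h"
    using assms unfolding annih_def by blast
  show ?thesis
    by (rule kills_comp[OF assms(1) *(2,4)]) (use * assms(4) in \<open>auto simp: o_def\<close>)
qed

lemma annih_multiplicative:
  assumes "\<And>x y. g (x * y) = g x * g y" "g \<in> C"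
  shows "g \<in> annih C"
  unfolding annih_def using assms by (auto intro!: exI[of _ "[g]"])

section \<open>Powers of a multiplicative map under twisted differences\<close>

text \<open>A nonconstant polynomial has finite fibres, so it cannot send infinitely many values of
  \<sigma> to finitely many points. With the exponent 0 excluded, the term at \<open>D\<close> makes
  the polynomial nonconstant.\<close>

lemma finite_roots_infinite_range:
  fixes \<sigma> :: "'a::field \<Rightarrow> 'a"
  assumes "infinite (range \<sigma>)" "finite E" "0 \<notin> E" "D \<in> E" "b D \<noteq> 0"
  shows "infinite (range (\<lambda>y. \<Sum>d\<in>E. b d * \<sigma> y ^ d))"
proof
  assume fin: "finite (range (\<lambda>y. \<Sum>d\<in>E. b d * \<sigma> y ^ d))"
  define p where "p = (\<Sum>d\<in>E. monom (b d) d)"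
  have pval: "poly p t = (\<Sum>d\<in>E. b d * t ^ d)" for t
    by (simp add: p_def poly_sum poly_monom)
  have "coeff p D = b D"
    using assms by (simp add: p_def coeff_sum)
  then have "p - [:c:] \<noteq> 0" for c
    using assms by (cases D) (auto simp: poly_eq_iff)
  then have "finite {t. poly (p - [:c:]) t = 0}" for c
    by (rule poly_roots_finite)
  then have "finite (\<Union>c\<in>range (\<lambda>y. poly p (\<sigma> y)). {t. poly (p - [:c:]) t = 0})"
    using fin unfolding pval by (intro finite_UN_I) auto
  moreover have "range \<sigma> \<subseteq> (\<Union>c\<in>range (\<lambda>y. poly p (\<sigma> y)). {t. poly (p - [:c:]) t = 0})"
    by auto
  ultimately show False using assms(1) finite_subset by blast
qed

text \<open>Each operator multiplies the coefficient \<open>b d\<close> by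
  \<open>\<sigma> x ^ d - \<tau> x\<close>. If no \<tau> in the list is the power map
  \<open>\<lambda>x. \<sigma> x ^ D\<close>, then \<open>x\<close> can be chosen at each stage so
  that the coefficient at \<open>D\<close> survives, and the last sum still has infinite
  range.\<close>

lemma kills_power_sum:
  fixes \<sigma> :: "'a::field \<Rightarrow> 'a"
  assumes "kills \<tau>s (\<lambda>y. \<Sum>d\<in>E. b d * \<sigma> y ^ d)"
    and "\<And>x y. \<sigma> (x * y) = \<sigma> x * \<sigma> y" "infinite (range \<sigma>)"
    and "finite E" "0 \<notin> E" "D \<in> E" "b D \<noteq> 0"
  shows "(\<lambda>x. \<sigma> x ^ D) \<in> set \<tau>s"
  using assms(1,7)
proof (induction \<tau>s arbitrary: b)
  case Nil
  then show ?case using finite_roots_infinite_range[of \<sigma> E D b] assms by simp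
next
  case (Cons \<tau> \<tau>s)
  show ?case
  proof (cases "\<tau> = (\<lambda>x. \<sigma> x ^ D)")
    case False
    then obtain x where x: "\<tau> x \<noteq> \<sigma> x ^ D" by blast
    have "kills \<tau>s (\<lambda>y. (\<Sum>d\<in>E. b d * \<sigma> (x * y) ^ d) - \<tau> x * (\<Sum>d\<in>E. b d * \<sigma> y ^ d))"
      using Cons.prems by simp
    then have "kills \<tau>s (\<lambda>y. \<Sum>d\<in>E. (b d * (\<sigma> x ^ d - \<tau> x)) * \<sigma> y ^ d)"
      by (simp add: assms(2) power_mult_distrib sum_distrib_left sum_subtractf algebra_simps)
    moreover have "b D * (\<sigma> x ^ D - \<tau> x) \<noteq> 0" using x Cons.prems by auto
    ultimately show ?thesis using Cons.IH[of "\<lambda>d. b d * (\<sigma> x ^ d - \<tau> x)"] by auto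
  qed auto
qed

lemma annih_power_sum:
  fixes \<sigma> :: "'a::field \<Rightarrow> 'a"
  assumes "(\<lambda>y. \<Sum>d\<in>E. b d * \<sigma> y ^ d) \<in> annih C"
    and "\<And>x y. \<sigma> (x * y) = \<sigma> x * \<sigma> y" "infinite (range \<sigma>)"
    and "finite E" "0 \<notin> E" "D \<in> E" "b D \<noteq> 0"
  shows "(\<lambda>x. \<sigma> x ^ D) \<in> C"
proof -
  obtain \<tau>s where "set \<tau>s \<subseteq> C" "kills \<tau>s (\<lambda>y. \<Sum>d\<in>E. b d * \<sigma> y ^ d)"
    using assms(1) unfolding annih_def by blast
  with kills_power_sum[where \<tau>s = \<tau>s and b = b and E = E and \<sigma> = \<sigma> and D = D] assms
  show ?thesis by blast
qed

lemma compositions_comp: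
  assumes "\<sigma> \<in> compositions G" "\<tau> \<in> compositions G"
  shows "\<sigma> \<circ> \<tau> \<in> compositions G"
proof -
  obtain xs ys where *: "\<sigma> = foldr (\<circ>) xs id" "\<tau> = foldr (\<circ>) ys id" "set xs \<subseteq> G" "set ys \<subseteq> G"
    using assms unfolding compositions_def by blast
  have "foldr (\<circ>) xs id \<circ> \<rho> = foldr (\<circ>) xs \<rho>" for \<rho>
    by (induction xs) (auto simp: fun_eq_iff)
  then have "\<sigma> \<circ> \<tau> = foldr (\<circ>) (xs @ ys) id" by (simp add: *)
  moreover have "set (xs @ ys) \<subseteq> G" using * by simp
  ultimately show ?thesis unfolding compositions_def by blast
qed

lemma id_in_compositions: "id \<in> compositions G"
  unfolding compositions_def by (force intro: exI[of _ "[]"])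

lemma generator_in_compositions: "g \<in> G \<Longrightarrow> g \<in> compositions G"
  unfolding compositions_def by (rule CollectI, rule exI[of _ "[g]"]) simp

section \<open>Irreducible components under translations\<close>

text \<open>The family need not be closed under unions, hence finite covers in place of covers by
  two sets. The empty cover shows that irreducible sets are nonempty.\<close>

definition irreducible_in :: "'g set set \<Rightarrow> 'g set \<Rightarrow> bool" where
  "irreducible_in \<C> Z \<longleftrightarrow> Z \<in> \<C> \<and>
     (\<forall>\<Y>. finite \<Y> \<and> \<Y> \<subseteq> \<C> \<and> Z \<subseteq> \<Union>\<Y> \<longrightarrow> (\<exists>Y\<in>\<Y>. Z \<subseteq> Y))"

lemma irreducible_inD:
  assumes "irreducible_in \<C> Z" "finite \<Y>" "\<Y> \<subseteq> \<C>" "Z \<subseteq> \<Union>\<Y>"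
  obtains Y where "Y \<in> \<Y>" "Z \<subseteq> Y"
  using assms unfolding irreducible_in_def by auto

text \<open>Noetherian induction, with \<open>m\<close> standing in for the descending chain
  condition: a reducible \<open>Z\<close> is the union of finitely many strictly smaller
  intersections \<open>Z \<inter> Y\<close>.\<close>

lemma finite_union_of_irreducibles:
  fixes m :: "'g set \<Rightarrow> nat"
  assumes "\<And>A B. A \<in> \<C> \<Longrightarrow> B \<in> \<C> \<Longrightarrow> A \<inter> B \<in> \<C>"
    and "\<And>A B. A \<in> \<C> \<Longrightarrow> B \<in> \<C> \<Longrightarrow> A \<subset> B \<Longrightarrow> m A < m B"
    and "Z \<in> \<C>"
  shows "\<exists>\<D>. finite \<D> \<and> (\<forall>D\<in>\<D>. irreducible_in \<C> D) \<and> Z = \<Union>\<D>"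
  using assms(3)
proof (induction "m Z" arbitrary: Z rule: less_induct)
  case less
  show ?case
  proof (cases "irreducible_in \<C> Z")
    case True
    then show ?thesis by (intro exI[of _ "{Z}"]) auto
  next
    case False
    then obtain \<Y> where Y: "finite \<Y>" "\<Y> \<subseteq> \<C>" "Z \<subseteq> \<Union>\<Y>" "\<forall>Y\<in>\<Y>. \<not> Z \<subseteq> Y"
      using less.prems unfolding irreducible_in_def by auto
    have "\<forall>Y\<in>\<Y>. \<exists>\<D>. finite \<D> \<and> (\<forall>D\<in>\<D>. irreducible_in \<C> D) \<and> Z \<inter> Y = \<Union>\<D>"
    proof
      fix Y assume "Y \<in> \<Y>"
      then have "Z \<inter> Y \<in> \<C>" using Y(2) less.prems assms(1)[of Z Y] by blast
      moreover have "Z \<inter> Y \<subset> Z" using Y(4) \<open>Y \<in> \<Y>\<close> by auto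
      ultimately show "\<exists>\<D>. finite \<D> \<and> (\<forall>D\<in>\<D>. irreducible_in \<C> D) \<and> Z \<inter> Y = \<Union>\<D>"
        using less.hyps[of "Z \<inter> Y"] assms(2) less.prems by simp
    qed
    then obtain \<D> where D: "\<forall>Y\<in>\<Y>. finite (\<D> Y) \<and> (\<forall>D\<in>\<D> Y. irreducible_in \<C> D) \<and> Z \<inter> Y = \<Union>(\<D> Y)"
      by (rule bchoice[THEN exE])
    have "Z = (\<Union>Y\<in>\<Y>. Z \<inter> Y)" using Y(3) by blast
    also have "\<dots> = (\<Union>Y\<in>\<Y>. \<Union>(\<D> Y))" using D by simp
    also have "\<dots> = \<Union>(\<Union>Y\<in>\<Y>. \<D> Y)" by blast
    finally have "Z = \<Union>(\<Union>Y\<in>\<Y>. \<D> Y)" .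
    moreover have "finite (\<Union>Y\<in>\<Y>. \<D> Y)" "\<forall>D\<in>(\<Union>Y\<in>\<Y>. \<D> Y). irreducible_in \<C> D"
      using D Y(1) by simp_all
    ultimately show ?thesis by metis
  qed
qed

lemma irreducible_in_translate:
  fixes Z :: "'g::ab_group_add set"
  assumes trans: "\<And>A c. A \<in> \<C> \<Longrightarrow> (+) c ` A \<in> \<C>" and Z: "irreducible_in \<C> Z"
  shows "irreducible_in \<C> ((+) c ` Z)"
  unfolding irreducible_in_def
proof (intro conjI allI impI)
  show "(+) c ` Z \<in> \<C>" using trans Z unfolding irreducible_in_def by blast
  fix \<Y> assume Y: "finite \<Y> \<and> \<Y> \<subseteq> \<C> \<and> (+) c ` Z \<subseteq> \<Union>\<Y>"
  have "z \<in> (\<Union>Y\<in>\<Y>. (+) (- c) ` Y)" if "z \<in> Z" for z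
  proof -
    have "c + z \<in> \<Union>\<Y>" using Y that by auto
    then obtain Y where "Y \<in> \<Y>" "c + z \<in> Y" by auto
    then have "z \<in> (+) (- c) ` Y" by (intro image_eqI[of _ _ "c + z"]) simp_all
    then show ?thesis using \<open>Y \<in> \<Y>\<close> by (rule UN_I[rotated])
  qed
  then have "Z \<subseteq> \<Union>((`) ((+) (- c)) ` \<Y>)" by (rule subsetI)
  moreover have "finite ((`) ((+) (- c)) ` \<Y>)" using Y by simp
  moreover have "(`) ((+) (- c)) ` \<Y> \<subseteq> \<C>" using Y trans[of _ "- c"] by (intro image_subsetI) blast
  ultimately obtain A where "A \<in> (`) ((+) (- c)) ` \<Y>" "Z \<subseteq> A"
    using irreducible_inD[OF Z] by metis
  then obtain Y where "Y \<in> \<Y>" "Z \<subseteq> (+) (- c) ` Y" by auto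
  moreover from this have "(+) c ` Z \<subseteq> Y" by force
  ultimately show "\<exists>Y\<in>\<Y>. (+) c ` Z \<subseteq> Y" by blast
qed

text \<open>Translations permute the irreducible components of the whole group.\<close>

lemma irreducible_with_finite_orbit:
  fixes m :: "'g::ab_group_add set \<Rightarrow> nat"
  assumes inter: "\<And>A B. A \<in> \<C> \<Longrightarrow> B \<in> \<C> \<Longrightarrow> A \<inter> B \<in> \<C>"
    and strict: "\<And>A B. A \<in> \<C> \<Longrightarrow> B \<in> \<C> \<Longrightarrow> A \<subset> B \<Longrightarrow> m A < m B"
    and UNIV: "UNIV \<in> \<C>" and trans: "\<And>A c. A \<in> \<C> \<Longrightarrow> (+) c ` A \<in> \<C>"
  obtains Z where "irreducible_in \<C> Z" "finite (range (\<lambda>c. (+) c ` Z))"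
proof -
  have "\<exists>\<D>. finite \<D> \<and> (\<forall>D\<in>\<D>. irreducible_in \<C> D) \<and> UNIV = \<Union>\<D>"
    by (rule finite_union_of_irreducibles[of \<C> m UNIV]) (fact inter strict UNIV)+
  then obtain \<D> where D: "finite \<D>" "\<forall>D\<in>\<D>. irreducible_in \<C> D" "UNIV = \<Union>\<D>"
    by auto
  have "\<D> \<noteq> {}" using D(3) by auto
  \<comment> \<open>The decomposition may be redundant; a maximal member of it is a true irreducible
    component.\<close>
  then obtain Z where Z: "Z \<in> \<D>" "\<forall>D\<in>\<D>. Z \<subseteq> D \<longrightarrow> Z = D"
    using finite_has_maximal[OF D(1)] by auto
  have sub: "\<D> \<subseteq> \<C>" using D(2) unfolding irreducible_in_def by auto
  have "(+) c ` Z \<in> \<D>" for c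
  proof -
    have cover: "\<exists>D\<in>\<D>. (+) d ` A \<subseteq> D" if "A \<in> \<D>" for d A
    proof -
      have "irreducible_in \<C> ((+) d ` A)"
        using that D(2) by (intro irreducible_in_translate[OF trans]) auto
      moreover have "(+) d ` A \<subseteq> \<Union>\<D>" unfolding D(3)[symmetric] by simp
      ultimately show ?thesis using D(1) sub unfolding irreducible_in_def by simp
    qed
    obtain D where D': "D \<in> \<D>" "(+) c ` Z \<subseteq> D" using cover Z by blast
    \<comment> \<open>Translating back puts \<open>Z\<close> inside \<open>D2\<close>. Maximality
      forces \<open>Z = D2\<close>, so that \<open>D\<close> is exactly the translate of
      \<open>Z\<close>.\<close>
    obtain D2 where D2: "D2 \<in> \<D>" "(+) (- c) ` D \<subseteq> D2" using cover D' by blast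
    have "Z \<subseteq> (+) (- c) ` D"
    proof
      fix z assume "z \<in> Z"
      then have "c + z \<in> D" using D' by blast
      then show "z \<in> (+) (- c) ` D" by (intro image_eqI[of _ _ "c + z"]) auto
    qed
    then have "(+) (- c) ` D \<subseteq> Z" using D2 Z(2) by fastforce
    then have "D \<subseteq> (+) c ` Z"
    proof -
      have "x \<in> (+) c ` Z" if "x \<in> D" for x
        using \<open>(+) (- c) ` D \<subseteq> Z\<close> that by (intro image_eqI[of _ _ "- c + x"]) auto
      then show ?thesis by blast
    qed
    then show ?thesis using D' by auto
  qed
  then have "range (\<lambda>c. (+) c ` Z) \<subseteq> \<D>" by blast
  then have "finite (range (\<lambda>c. (+) c ` Z))" using D(1) by (rule finite_subset)
  then show thesis using D(2) Z(1) by (intro that[of Z]) auto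
qed

section \<open>Zero sets of finite-dimensional families of functions\<close>

interpretation fun_vs: vector_space "\<lambda>(c::'a::field) (g::'g \<Rightarrow> 'a) x. c * g x"
  by standard (auto simp: fun_eq_iff algebra_simps)

definition zero_set :: "('g \<Rightarrow> 'a::zero) set \<Rightarrow> 'g set" where
  "zero_set F = {x. \<forall>g\<in>F. g x = 0}"

definition zero_sets :: "('g \<Rightarrow> 'a::zero) set \<Rightarrow> 'g set set" where
  "zero_sets V = zero_set ` Pow V"

lemma zero_sets_Int: "A \<in> zero_sets V \<Longrightarrow> B \<in> zero_sets V \<Longrightarrow> A \<inter> B \<in> zero_sets V"
proof -
  assume "A \<in> zero_sets V" "B \<in> zero_sets V"
  then obtain F G where "F \<subseteq> V" "A = zero_set F" "G \<subseteq> V" "B = zero_set G"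
    unfolding zero_sets_def by blast
  then have "A \<inter> B = zero_set (F \<union> G)" "F \<union> G \<subseteq> V" unfolding zero_set_def by auto
  then show ?thesis unfolding zero_sets_def by blast
qed

lemma UNIV_in_zero_sets: "UNIV \<in> zero_sets V"
  unfolding zero_sets_def by (rule image_eqI[of _ _ "{}"]) (auto simp: zero_set_def)

lemma zero_sets_translate:
  fixes A :: "'g::ab_group_add set"
  assumes "\<And>g c. g \<in> V \<Longrightarrow> (\<lambda>x. g (x + c)) \<in> V" "A \<in> zero_sets V"
  shows "(+) c ` A \<in> zero_sets V"
proof -
  obtain F where F: "F \<subseteq> V" "A = zero_set F" using assms(2) unfolding zero_sets_def by blast
  have "(+) c ` A = zero_set ((\<lambda>g x. g (x + (- c))) ` F)"
  proof (intro equalityI subsetI)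
    fix x assume "x \<in> zero_set ((\<lambda>g x. g (x + (- c))) ` F)"
    then have "x - c \<in> A" unfolding F(2) zero_set_def by simp
    then show "x \<in> (+) c ` A" by (intro image_eqI[of _ _ "x - c"]) auto
  qed (auto simp: F(2) zero_set_def)
  moreover have "(\<lambda>g x. g (x + (- c))) ` F \<subseteq> V" using assms(1)[of _ "- c"] F(1) by blast
  ultimately show ?thesis unfolding zero_sets_def by blast
qed

text \<open>The larger \<open>A\<close>, the fewer functions of \<open>V\<close> vanish on it, and
  \<open>A\<close> is recovered as the common zero set of those that do. So \<open>card T\<close>
  minus the dimension of their span strictly increases with \<open>A\<close>.\<close>

lemma zero_sets_measure:
  fixes T :: "('g \<Rightarrow> 'a::field) set"
  assumes "finite T" "V \<subseteq> fun_vs.span T"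
  obtains m :: "'g set \<Rightarrow> nat"
  where "\<And>A B. A \<in> zero_sets V \<Longrightarrow> B \<in> zero_sets V \<Longrightarrow> A \<subset> B \<Longrightarrow> m A < m B"
proof
  define U where "U A = {g \<in> V. \<forall>x\<in>A. g x = 0}" for A
  define m where "m A = card T - fun_vs.dim (U A)" for A
  fix A B assume AB: "A \<in> zero_sets V" "B \<in> zero_sets V" "A \<subset> B"
  have U_zero: "zero_set (U A) = A" if "A \<in> zero_sets V" for A
    using that unfolding zero_sets_def U_def zero_set_def by blast
  obtain M where M: "M \<subseteq> U B" "fun_vs.independent M" "U B \<subseteq> fun_vs.span M" "card M = fun_vs.dim (U B)"
    using fun_vs.basis_exists[of "U B"] by blast
  have "U B \<subseteq> U A" using AB unfolding U_def by blast
  have "U A \<noteq> U B" using U_zero[OF AB(1)] U_zero[OF AB(2)] AB(3) by (metis psubset_eq)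
  with \<open>U B \<subseteq> U A\<close> have "\<exists>g. g \<in> U A \<and> g \<notin> U B" by auto
  then obtain g where g: "g \<in> U A" "g \<notin> U B" by auto
  then obtain x where x: "x \<in> B" "g x \<noteq> 0" unfolding U_def by blast
  \<comment> \<open>\<open>V\<close> is not assumed to be a subspace, so
    \<open>g \<notin> U B\<close> alone does not exclude \<open>g\<close> from
    \<open>fun_vs.span M\<close>; the point \<open>x\<close> of \<open>B\<close> with
    \<open>g x \<noteq> 0\<close> does.\<close>
  have "h x = 0" if "h \<in> fun_vs.span M" for h
    using that
  proof (induction rule: fun_vs.span_induct_alt)
    case (step c g y)
    then have "g \<in> U B" using M by blast
    then show ?case using step x unfolding U_def by simp
  qed simp
  then have "g \<notin> fun_vs.span M" using x by blast
  then have ind: "fun_vs.independent (insert g M)" using M fun_vs.independent_insertI by blast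
  have "insert g M \<subseteq> U A" using g M \<open>U B \<subseteq> U A\<close> by blast
  then obtain N where N: "insert g M \<subseteq> N" "N \<subseteq> U A" "fun_vs.independent N" "U A \<subseteq> fun_vs.span N"
    using fun_vs.maximal_independent_subset_extend[OF _ ind] by blast
  have "U A \<subseteq> fun_vs.span T" using assms(2) unfolding U_def by blast
  then have finN: "finite N" "card N \<le> card T"
    using fun_vs.independent_span_bound[OF assms(1) N(3)] N(2) by auto
  have "card N = fun_vs.dim (U A)"
    using fun_vs.basis_card_eq_dim N by blast
  moreover have "card M < card N"
  proof -
    have "finite (insert g M)" by (rule finite_subset[OF N(1) finN(1)])
    moreover have "g \<notin> M" using \<open>g \<notin> fun_vs.span M\<close> fun_vs.span_base[of g M] by auto
    ultimately have "card M < card (insert g M)" by simp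
    also have "\<dots> \<le> card N" by (rule card_mono[OF finN(1) N(1)])
    finally show ?thesis .
  qed
  ultimately show "m A < m B" using M(4) finN unfolding m_def by linarith
qed

section \<open>Polynomial functions in additive maps\<close>

text \<open>In characteristic 0 the side condition leaves only \<open>0 ^ 0 = 1\<close>, that is,
  the exponent 1. Otherwise these are the exponents of the iterates of Frobenius.\<close>

definition char_powers :: "'a::semiring_1 itself \<Rightarrow> nat set" where
  "char_powers _ = {CHAR('a) ^ j | j. CHAR('a) = 0 \<longrightarrow> j = 0}"

lemma CHAR_field_prime: "CHAR('a::field) > 0 \<Longrightarrow> prime CHAR('a)"
  by (rule prime_CHAR_semidom)

text \<open>If \<open>e\<close> is not 1, the coefficient \<open>e choose 1\<close> makes the
  characteristic a prime \<open>p\<close> dividing \<open>e\<close>. For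
  \<open>e = p ^ k * m\<close> with \<open>p\<close> not dividing \<open>m\<close>, the coefficient
  \<open>e choose p ^ k\<close> is prime to \<open>p\<close>, so \<open>p ^ k\<close> cannot lie
  strictly below \<open>e\<close>.\<close>

lemma char_powersI:
  assumes "e > 0" "\<And>d. 0 < d \<Longrightarrow> d < e \<Longrightarrow> of_nat (e choose d) = (0::'a::field)"
  shows "e \<in> char_powers TYPE('a)"
proof (cases "e = 1")
  case True
  then show ?thesis unfolding char_powers_def by (auto intro: exI[of _ 0])
next
  case False
  then have "of_nat e = (0::'a)" using assms(2)[of 1] assms(1) by simp
  then have pos: "CHAR('a) > 0" using assms(1) CHAR_pos_iff by blast
  define p where "p = CHAR('a)"
  have p: "prime p" unfolding p_def by (rule CHAR_field_prime[OF pos])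
  obtain m where m: "e = p ^ multiplicity p e * m" "\<not> p dvd m"
    using multiplicity_decompose'[of e p] assms(1) p by (metis not_prime_unit not_gr_zero)
  define k where "k = multiplicity p e"
  have "m > 0" using m assms(1) by (cases m) auto
  have "\<not> p dvd (p ^ k * m choose p ^ k)"
  proof -
    have "multiplicity p (p ^ k * m choose p ^ k) = 0"
      using const_p_fac[OF \<open>m > 0\<close> p, of k] m(2) by (simp add: not_dvd_imp_multiplicity_0)
    moreover have "(p ^ k * m choose p ^ k) \<noteq> 0"
      using \<open>m > 0\<close> p by (simp add: prime_gt_0_nat)
    ultimately show ?thesis
      using multiplicity_eq_zero_iff[of "p ^ k * m choose p ^ k" p] p not_prime_unit by blast
  qed
  then have "of_nat (e choose p ^ k) \<noteq> (0::'a)"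
    using m(1) by (simp add: of_nat_eq_0_iff_char_dvd p_def k_def)
  then have "\<not> p ^ k < e" using assms(2)[of "p ^ k"] p by (auto simp: prime_gt_0_nat)
  then have "m = 1" using m(1) \<open>m > 0\<close> p k_def
    by (metis One_nat_def Suc_lessI mult.right_neutral nat_mult_less_cancel1 prime_gt_0_nat zero_less_power)
  then show ?thesis using m(1) pos unfolding char_powers_def p_def k_def by auto
qed

lemma char_powers_add:
  assumes "e \<in> char_powers TYPE('a)"
  shows "(x + y :: 'a::field) ^ e = x ^ e + y ^ e"
proof -
  obtain j where j: "e = CHAR('a) ^ j" "CHAR('a) = 0 \<longrightarrow> j = 0"
    using assms unfolding char_powers_def by auto
  show ?thesis
  proof (cases "CHAR('a) = 0")
    case False
    then have "prime CHAR('a)" by (intro CHAR_field_prime) simp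
    then show ?thesis using j(1) by (rule freshmans_dream')
  next
    case True
    then have "e = 1" using j by simp
    then show ?thesis by simp
  qed
qed

text \<open>The inner sums are the coefficients of the translated polynomial. Both indices may run
  over the same range because \<open>e choose d\<close> vanishes for \<open>d > e\<close>, exactly
  where \<open>e - d\<close> is truncated.\<close>

lemma power_add_regroup:
  fixes a b :: "'a::comm_ring_1"
  shows "(\<Sum>e\<le>D. r e * (a + b) ^ e) = (\<Sum>d\<le>D. (\<Sum>e\<le>D. of_nat (e choose d) * r e * b ^ (e - d)) * a ^ d)"
proof -
  have "r e * (a + b) ^ e = (\<Sum>d\<le>D. of_nat (e choose d) * r e * b ^ (e - d) * a ^ d)" if "e \<le> D" for e
  proof -
    have "(a + b) ^ e = (\<Sum>d\<le>e. of_nat (e choose d) * a ^ d * b ^ (e - d))"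
      by (rule binomial_ring)
    also have "\<dots> = (\<Sum>d\<le>D. of_nat (e choose d) * a ^ d * b ^ (e - d))"
      using that by (intro sum.mono_neutral_left) (auto simp: binomial_eq_0)
    finally show ?thesis by (simp add: sum_distrib_left mult_ac)
  qed
  then have "(\<Sum>e\<le>D. r e * (a + b) ^ e) = (\<Sum>e\<le>D. \<Sum>d\<le>D. of_nat (e choose d) * r e * b ^ (e - d) * a ^ d)"
    by (intro sum.cong) auto
  also have "\<dots> = (\<Sum>d\<le>D. \<Sum>e\<le>D. of_nat (e choose d) * r e * b ^ (e - d) * a ^ d)"
    by (rule sum.swap)
  finally show ?thesis by (simp add: sum_distrib_right)
qed

section \<open>Polynomials of bounded degree in a set of functions\<close>

text \<open>The number bounds the degree of some presentation. It is no invariant of the function,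
  since members of \<open>S\<close> may be algebraically dependent.\<close>

inductive pdeg :: "('g \<Rightarrow> 'a::field) set \<Rightarrow> nat \<Rightarrow> ('g \<Rightarrow> 'a) \<Rightarrow> bool" for S where
  const: "pdeg S 0 (\<lambda>_. c)"
| mult: "u \<in> S \<Longrightarrow> pdeg S n r \<Longrightarrow> pdeg S (Suc n) (\<lambda>x. u x * r x)"
| add: "pdeg S n r \<Longrightarrow> pdeg S n q \<Longrightarrow> pdeg S n (\<lambda>x. r x + q x)"
| Suc: "pdeg S n r \<Longrightarrow> pdeg S (Suc n) r"

lemma pdeg_mono: "pdeg S n r \<Longrightarrow> n \<le> m \<Longrightarrow> pdeg S m r"
  by (induction m) (auto simp: le_Suc_eq intro: pdeg.Suc)

lemma pdeg_subset: "pdeg S n r \<Longrightarrow> S \<subseteq> S' \<Longrightarrow> pdeg S' n r"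
  by (induction rule: pdeg.induct) (auto intro: pdeg.intros)

lemma pdeg_scale: "pdeg S n r \<Longrightarrow> pdeg S n (\<lambda>x. c * r x)"
proof (induction rule: pdeg.induct)
  case (mult u n r)
  then show ?case using pdeg.mult[of u S n "\<lambda>x. c * r x"] by (simp add: mult_ac)
next
  case (add n r q)
  then show ?case using pdeg.add[of S n "\<lambda>x. c * r x" "\<lambda>x. c * q x"] by (simp add: algebra_simps)
qed (auto intro: pdeg.intros)

lemma pdeg_times: "pdeg S n r \<Longrightarrow> pdeg S m q \<Longrightarrow> pdeg S (n + m) (\<lambda>x. r x * q x)"
proof (induction rule: pdeg.induct)
  case (mult u n r)
  then show ?case using pdeg.mult[of u S "n + m" "\<lambda>x. r x * q x"] by (simp add: mult_ac)
next
  case (add n r p)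
  then show ?case using pdeg.add[of S "n + m" "\<lambda>x. r x * q x" "\<lambda>x. p x * q x"] by (simp add: algebra_simps)
qed (auto intro: pdeg.intros pdeg_scale)

lemma pdeg_translate:
  assumes "\<And>u. u \<in> S \<Longrightarrow> additive u"
  shows "pdeg S n r \<Longrightarrow> pdeg S n (\<lambda>x. r (x + c))"
proof (induction rule: pdeg.induct)
  case (mult u n r)
  have "pdeg S (Suc n) (\<lambda>x. u x * r (x + c) + u c * r (x + c))"
    using mult by (intro pdeg.add pdeg.mult pdeg.Suc[OF pdeg_scale]) auto
  then show ?case using assms[OF mult(1)] by (simp add: additive.add algebra_simps)
qed (auto intro: pdeg.intros)

lemma pdeg_0: "pdeg S 0 r \<Longrightarrow> \<exists>k. r = (\<lambda>_. k)"
  by (induction "0::nat" r rule: pdeg.induct) auto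

text \<open>The product rule \<open>u (x + c) * r (x + c) - u x * r x = u x * (r (x + c) - r x) + u
  c * r (x + c)\<close>: induction handles the first summand, and the second has lost a factor
  \<open>u\<close>.\<close>

lemma pdeg_difference:
  assumes "\<And>u. u \<in> S \<Longrightarrow> additive u"
  shows "pdeg S n r \<Longrightarrow> n = Suc m \<Longrightarrow> pdeg S m (\<lambda>x. r (x + c) - r x)"
proof (induction arbitrary: m rule: pdeg.induct)
  case (mult u n r)
  have eq: "u (x + c) * r (x + c) - u x * r x = u x * (r (x + c) - r x) + u c * r (x + c)" for x
    using assms[OF mult(1)] by (simp add: additive.add algebra_simps)
  have "pdeg S n (\<lambda>x. u x * (r (x + c) - r x))"
  proof (cases n)
    case 0
    then obtain k where "r = (\<lambda>_. k)" using mult pdeg_0 by blast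
    then show ?thesis using 0 by (simp add: pdeg.const)
  next
    case (Suc l)
    then show ?thesis using mult by (auto intro: pdeg.mult)
  qed
  moreover have "pdeg S n (\<lambda>x. u c * r (x + c))"
    by (rule pdeg_scale[OF pdeg_translate[OF assms mult(2)]])
  ultimately show ?case using mult.prems unfolding eq by (auto intro: pdeg.add)
next
  case (add n r q)
  have "pdeg S m (\<lambda>x. (r (x + c) - r x) + (q (x + c) - q x))"
    using add by (intro pdeg.add) auto
  then show ?case by (simp add: algebra_simps)
next
  case (Suc n r)
  have "pdeg S n (\<lambda>x. r (x + c) + (- 1) * r x)"
    using Suc by (intro pdeg.add pdeg_translate pdeg_scale assms) auto
  then show ?case using Suc by simp
qed simp

lemma pdeg_finite_span:
  assumes "finite S"
  shows "\<exists>T. finite T \<and> Collect (pdeg S n) \<subseteq> fun_vs.span T"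
proof -
  \<comment> \<open>\<open>T n\<close> consists of the monomials of degree at most \<open>n\<close>
    in the members of \<open>S\<close>.\<close>
  define T where "T = rec_nat {\<lambda>_. 1} (\<lambda>_ T. T \<union> (\<lambda>(u, g) x. u x * g x) ` (S \<times> T))"
  have T: "T 0 = {\<lambda>_. 1}" "\<And>n. T (Suc n) = T n \<union> (\<lambda>(u, g) x. u x * g x) ` (S \<times> T n)"
    unfolding T_def by auto
  have "finite (T n)" for n by (induction n) (auto simp: T assms)
  moreover have "r \<in> fun_vs.span (T n)" if "pdeg S n r" for n r
    using that
  proof (induction rule: pdeg.induct)
    case (const c)
    have "(\<lambda>x. c * (\<lambda>_. 1) x) \<in> fun_vs.span (T 0)"
      by (intro fun_vs.span_scale fun_vs.span_base) (simp add: T)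
    then show ?case by simp
  next
    case (mult u n r)
    from mult(3) show ?case
    proof (induction rule: fun_vs.span_induct_alt)
      case base
      have "(\<lambda>x. u x * 0 x) = 0" by (simp add: fun_eq_iff)
      then show ?case by (metis fun_vs.span_zero)
    next
      case (step c g h)
      have "(\<lambda>x. u x * g x) \<in> T (Suc n)" using step mult T by force
      then have "(\<lambda>x. c * (u x * g x)) + (\<lambda>x. u x * h x) \<in> fun_vs.span (T (Suc n))"
        by (intro fun_vs.span_add[OF fun_vs.span_scale[OF fun_vs.span_base]] step)
      then show ?case by (simp add: plus_fun_def algebra_simps)
    qed
  next
    case (add n r q)
    then show ?case using fun_vs.span_add[of r "T n" q] by (simp add: plus_fun_def)
  next
    case (Suc n r)
    then show ?case using fun_vs.span_mono[of "T n" "T (Suc n)"] T by blast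
  qed
  ultimately show ?thesis by blast
qed

definition polyfuns :: "('g \<Rightarrow> 'a::field) set \<Rightarrow> ('g \<Rightarrow> 'a) set" where
  "polyfuns S = {r. \<exists>n. pdeg S n r}"

lemma polyfuns_const: "(\<lambda>_. c) \<in> polyfuns S"
  unfolding polyfuns_def using pdeg.const by blast

lemma polyfuns_base:
  assumes "u \<in> S"
  shows "u \<in> polyfuns S"
proof -
  have "pdeg S (Suc 0) (\<lambda>x. u x * 1)" by (rule pdeg.mult[OF assms pdeg.const])
  then show ?thesis unfolding polyfuns_def by auto
qed

lemma polyfuns_add:
  assumes "r \<in> polyfuns S" "q \<in> polyfuns S"
  shows "(\<lambda>x. r x + q x) \<in> polyfuns S"
proof -
  obtain n m where "pdeg S n r" "pdeg S m q" using assms unfolding polyfuns_def by auto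
  then have "pdeg S (n + m) (\<lambda>x. r x + q x)"
    by (intro pdeg.add) (auto elim: pdeg_mono)
  then show ?thesis unfolding polyfuns_def by auto
qed

lemma polyfuns_mult: "r \<in> polyfuns S \<Longrightarrow> q \<in> polyfuns S \<Longrightarrow> (\<lambda>x. r x * q x) \<in> polyfuns S"
  unfolding polyfuns_def using pdeg_times by blast

lemma polyfuns_scale: "r \<in> polyfuns S \<Longrightarrow> (\<lambda>x. c * r x) \<in> polyfuns S"
  unfolding polyfuns_def using pdeg_scale by blast

lemma polyfuns_diff:
  assumes "r \<in> polyfuns S" "q \<in> polyfuns S"
  shows "(\<lambda>x. r x - q x) \<in> polyfuns S"
  using polyfuns_add[OF assms(1) polyfuns_scale[OF assms(2), of "- 1"]] by simp

lemma polyfuns_sum: "(\<And>i. i \<in> A \<Longrightarrow> r i \<in> polyfuns S) \<Longrightarrow> (\<lambda>x. \<Sum>i\<in>A. r i x) \<in> polyfuns S"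
  by (induction A rule: infinite_finite_induct) (simp_all add: polyfuns_const polyfuns_add)

lemma polyfuns_translate:
  "(\<And>u. u \<in> S \<Longrightarrow> additive u) \<Longrightarrow> r \<in> polyfuns S \<Longrightarrow> (\<lambda>x. r (x + c)) \<in> polyfuns S"
  unfolding polyfuns_def using pdeg_translate by blast

lemma polyfuns_mono: "r \<in> polyfuns S \<Longrightarrow> S \<subseteq> S' \<Longrightarrow> r \<in> polyfuns S'"
  unfolding polyfuns_def using pdeg_subset by blast

lemma polyfuns_power: "r \<in> polyfuns S \<Longrightarrow> (\<lambda>x. r x ^ n) \<in> polyfuns S"
  by (induction n) (auto simp: polyfuns_const polyfuns_mult)

section \<open>Polynomial relations of minimal degree on an additive subset\<close>

locale additive_subset =
  fixes \<Gamma> :: "'g::ab_group_add set"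
  assumes zero_mem: "0 \<in> \<Gamma>" and add_mem: "x \<in> \<Gamma> \<Longrightarrow> y \<in> \<Gamma> \<Longrightarrow> x + y \<in> \<Gamma>"
begin

text \<open>Linear independence of \<open>1, u, ..., u ^ (D - 1)\<close> over the ring of polynomial
  functions in \<open>S\<close> restricted to \<Gamma>. This ring may have zero divisors, so one
  cannot simply divide by leading coefficients.\<close>

definition indep_below :: "('g \<Rightarrow> 'a::field) set \<Rightarrow> ('g \<Rightarrow> 'a) \<Rightarrow> nat \<Rightarrow> bool" where
  "indep_below S u D \<longleftrightarrow> (\<forall>q. (\<forall>d. q d \<in> polyfuns S) \<longrightarrow>
     (\<forall>x\<in>\<Gamma>. (\<Sum>d<D. q d x * u x ^ d) = 0) \<longrightarrow> (\<forall>d<D. \<forall>x\<in>\<Gamma>. q d x = 0))"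

lemma indep_belowD:
  assumes "indep_below S u D" "\<And>d. q d \<in> polyfuns S"
    and "\<And>x. x \<in> \<Gamma> \<Longrightarrow> (\<Sum>d<D. q d x * u x ^ d) = 0" "d < D" "x \<in> \<Gamma>"
  shows "q d x = 0"
  using assms unfolding indep_below_def by simp

text \<open>
  Comparing coefficients in \<open>P (x + c) = P x + P c\<close> at \<open>x = 0\<close> yields relations in \<open>u c\<close> of
  degree less than \<open>D\<close>, which must again be trivial.
\<close>

lemma additive_polynomial:
  fixes u :: "'g \<Rightarrow> 'a::field"
  assumes S: "\<And>w. w \<in> S \<Longrightarrow> additive w" and u: "additive u"
    and indep: "indep_below S u D" and D: "D > 0"
    and r: "\<And>d. r d \<in> polyfuns S" and top: "\<And>x. x \<in> \<Gamma> \<Longrightarrow> r D x = r D 0"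
    and P: "\<And>x. x \<in> \<Gamma> \<Longrightarrow> P x = (\<Sum>d\<le>D. r d x * u x ^ d)"
    and P_add: "\<And>x y. x \<in> \<Gamma> \<Longrightarrow> y \<in> \<Gamma> \<Longrightarrow> P (x + y) = P x + P y"
  shows "\<And>e x. 0 < e \<Longrightarrow> e \<le> D \<Longrightarrow> x \<in> \<Gamma> \<Longrightarrow> r e x = r e 0"
    and "\<And>e. 0 < e \<Longrightarrow> e \<le> D \<Longrightarrow> r e 0 \<noteq> 0 \<Longrightarrow> e \<in> char_powers TYPE('a)"
    and "\<And>x y. x \<in> \<Gamma> \<Longrightarrow> y \<in> \<Gamma> \<Longrightarrow> r 0 (x + y) = r 0 x + r 0 y"
    and "\<And>x. x \<in> \<Gamma> \<Longrightarrow> P x = r 0 x + (\<Sum>e\<in>{0<..D}. r e 0 * u x ^ e)"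
proof -
  \<comment> \<open>\<open>C d c x\<close> is the coefficient of \<open>u x ^ d\<close> in the
    expansion of \<open>P (x + c)\<close>.\<close>
  define C where "C d c x = (\<Sum>e\<le>D. of_nat (e choose d) * r e (x + c) * u c ^ (e - d))" for d c x
  have C_eq: "C d c x = r d x" if "0 < d" "d < D" "c \<in> \<Gamma>" "x \<in> \<Gamma>" for d c x
  proof -
    \<comment> \<open>The coefficients of \<open>P (x + c) - P x - P c\<close>, with the constant
      \<open>P c\<close> placed in degree 0.\<close>
    define q where "q d x = C d c x - r d x - (if d = 0 then P c else 0)" for d x
    have "q d \<in> polyfuns S" for d
    proof -
      have "(\<lambda>x. u c ^ (e - d) * (of_nat (e choose d) * r e (x + c))) \<in> polyfuns S" for e
        using r S by (intro polyfuns_scale polyfuns_translate) auto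
      then have "(\<lambda>x. C d c x) \<in> polyfuns S"
        unfolding C_def by (intro polyfuns_sum) (simp add: mult_ac)
      then show ?thesis
        unfolding q_def using r by (intro polyfuns_diff polyfuns_const) auto
    qed
    moreover have "(\<Sum>d<D. q d x * u x ^ d) = 0" if x: "x \<in> \<Gamma>" for x
    proof -
      have "P (x + c) = (\<Sum>e\<le>D. r e (x + c) * (u x + u c) ^ e)"
        using P[OF add_mem[OF x \<open>c \<in> \<Gamma>\<close>]] u by (simp add: additive.add)
      also have "\<dots> = (\<Sum>d\<le>D. C d c x * u x ^ d)"
        unfolding C_def by (rule power_add_regroup)
      finally have "(\<Sum>d\<le>D. C d c x * u x ^ d) = P x + P c"
        using P_add x \<open>c \<in> \<Gamma>\<close> by simp
      moreover have "P c = (\<Sum>d\<le>D. (if d = 0 then P c else 0) * u x ^ d)"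
        by (simp add: if_distrib[of "\<lambda>y. y * _"] cong: if_cong)
      ultimately have "(\<Sum>d\<le>D. q d x * u x ^ d) = 0"
        unfolding q_def left_diff_distrib sum_subtractf using P[OF x] by simp
      \<comment> \<open>Only \<open>e = D\<close> contributes in degree \<open>D\<close>, and
        \<open>r D\<close> is constant on \<Gamma>. The relation therefore has degree below
        \<open>D\<close>, and independence applies.\<close>
      moreover have "q D x = 0"
      proof -
        have "C D c x = (\<Sum>e\<in>{D}. of_nat (e choose D) * r e (x + c) * u c ^ (e - D))"
          unfolding C_def by (intro sum.mono_neutral_right) (auto simp: binomial_eq_0)
        then have "C D c x = r D (x + c)" by simp
        also have "\<dots> = r D x" using top[OF x] top[OF add_mem[OF x \<open>c \<in> \<Gamma>\<close>]] by simp
        finally show ?thesis using D unfolding q_def by simp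
      qed
      ultimately show ?thesis by (simp add: lessThan_Suc_atMost[symmetric])
    qed
    ultimately have "q d x = 0"
      by (rule indep_belowD[OF indep _ _ that(2,4)])
    then show ?thesis using that unfolding q_def by simp
  qed

  \<comment> \<open>This reads \<open>C_eq\<close> at the point 0 as a relation in the shift, with
    \<open>j = e - d\<close>; since \<open>d > 0\<close>, its degree is below \<open>D\<close>. The
    case \<open>j = 0\<close> makes \<open>r d\<close> constant, and \<open>j > 0\<close> kills
    \<open>r (j + d)\<close> times a binomial coefficient.\<close>
  have coeff: "of_nat ((j + d) choose d) * r (j + d) c - (if j = 0 then r d 0 else 0) = 0"
    if d: "0 < d" "d < D" and j: "j + d \<le> D" and c: "c \<in> \<Gamma>" for d j c
  proof -
    define q where "q j x = (if j + d \<le> D then of_nat ((j + d) choose d) * r (j + d) x else 0)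
      - (if j = 0 then r d 0 else 0)" for j x
    have "q j \<in> polyfuns S" for j
    proof -
      have "(\<lambda>x. if j + d \<le> D then of_nat ((j + d) choose d) * r (j + d) x else 0) \<in> polyfuns S"
        using r by (cases "j + d \<le> D") (auto intro: polyfuns_scale polyfuns_const)
      then show ?thesis unfolding q_def by (intro polyfuns_diff polyfuns_const)
    qed
    moreover have "(\<Sum>j<D. q j x * u x ^ j) = 0" if x: "x \<in> \<Gamma>" for x
    proof -
      have "r d 0 = C d x 0" using C_eq[OF d x zero_mem] by simp
      also have "\<dots> = (\<Sum>e\<le>D. of_nat (e choose d) * r e x * u x ^ (e - d))"
        unfolding C_def by simp
      also have "\<dots> = (\<Sum>e\<in>{d..D}. of_nat (e choose d) * r e x * u x ^ (e - d))"
        by (intro sum.mono_neutral_right) (auto simp: binomial_eq_0)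
      also have "\<dots> = (\<Sum>j\<in>{j. j + d \<le> D}. of_nat ((j + d) choose d) * r (j + d) x * u x ^ j)"
        by (rule sum.reindex_bij_witness[of _ "\<lambda>j. j + d" "\<lambda>e. e - d"]) auto
      also have "\<dots> = (\<Sum>j\<in>{j. j + d \<le> D}. (if j + d \<le> D then of_nat ((j + d) choose d) * r (j + d) x else 0) * u x ^ j)"
        by (intro sum.cong) auto
      also have "\<dots> = (\<Sum>j<D. (if j + d \<le> D then of_nat ((j + d) choose d) * r (j + d) x else 0) * u x ^ j)"
        using d by (intro sum.mono_neutral_left) auto
      finally have "(\<Sum>j<D. (if j + d \<le> D then of_nat ((j + d) choose d) * r (j + d) x else 0) * u x ^ j) = r d 0"
        by simp
      moreover have "(\<Sum>j<D. (if j = 0 then r d 0 else 0) * u x ^ j) = r d 0"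
        using D by (simp add: if_distrib[of "\<lambda>y. y * _"] cong: if_cong)
      ultimately show ?thesis unfolding q_def left_diff_distrib sum_subtractf by simp
    qed
    moreover have "j < D" using j d by simp
    ultimately have "q j c = 0" by (rule indep_belowD[OF indep _ _ _ c])
    then show ?thesis unfolding q_def using j by simp
  qed

  show const: "r e x = r e 0" if "0 < e" "e \<le> D" "x \<in> \<Gamma>" for e x
    using top coeff[of e 0 x] that by (cases "e = D") auto
  show powers: "e \<in> char_powers TYPE('a)" if "0 < e" "e \<le> D" "r e 0 \<noteq> 0" for e
  proof (rule char_powersI[OF that(1)])
    fix d assume "0 < d" "d < e"
    then show "of_nat (e choose d) = (0::'a)"
      using coeff[of d "e - d" 0] that zero_mem by auto
  qed
  \<comment> \<open>The part of \<open>P\<close> of positive degree is additive by the two facts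
    just shown, so the remainder \<open>r 0\<close> is additive on \<Gamma> as well.\<close>
  define H where "H x = (\<Sum>e\<in>{0<..D}. r e 0 * u x ^ e)" for x
  have P_eq: "P x = r 0 x + H x" if "x \<in> \<Gamma>" for x
  proof -
    have "{..D} = insert 0 {0<..D}" by auto
    then have "P x = r 0 x + (\<Sum>e\<in>{0<..D}. r e x * u x ^ e)"
      using P[OF that] by simp
    also have "(\<Sum>e\<in>{0<..D}. r e x * u x ^ e) = H x"
      unfolding H_def by (intro sum.cong) (use const that in auto)
    finally show ?thesis .
  qed
  then show "P x = r 0 x + (\<Sum>e\<in>{0<..D}. r e 0 * u x ^ e)" if "x \<in> \<Gamma>" for x
    using that unfolding H_def .
  fix x y assume xy: "x \<in> \<Gamma>" "y \<in> \<Gamma>"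
  have "r e 0 * (u x + u y) ^ e = r e 0 * u x ^ e + r e 0 * u y ^ e" if "e \<in> {0<..D}" for e
    using powers[of e] that char_powers_add[of e "u x" "u y"] by (cases "r e 0 = 0") (auto simp: algebra_simps)
  then have "H (x + y) = H x + H y"
    unfolding H_def using u by (simp add: additive.add sum.distrib)
  then show "r 0 (x + y) = r 0 x + r 0 y"
    using P_eq[OF xy(1)] P_eq[OF xy(2)] P_eq[OF add_mem[OF xy]] P_add[OF xy] by (simp add: algebra_simps)
qed

definition dependent :: "('g \<Rightarrow> 'a::field) set \<Rightarrow> ('g \<Rightarrow> 'a) \<Rightarrow> nat \<Rightarrow> bool" where
  "dependent S u D \<longleftrightarrow> (\<exists>r. (\<forall>d. r d \<in> polyfuns S) \<and> (\<exists>x\<in>\<Gamma>. r D x \<noteq> 0) \<and>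
     (\<forall>x\<in>\<Gamma>. (\<Sum>d\<le>D. r d x * u x ^ d) = 0))"

lemma indep_below_if_not_dependent:
  assumes "\<And>d. d < D \<Longrightarrow> \<not> dependent S u d"
  shows "indep_below S u D"
  unfolding indep_below_def
proof (intro allI impI ballI, rule ccontr)
  fix q d x
  assume q: "\<forall>d. q d \<in> polyfuns S" "\<forall>x\<in>\<Gamma>. (\<Sum>d<D. q d x * u x ^ d) = 0"
    and d: "d < D" "x \<in> \<Gamma>" "q d x \<noteq> 0"
  define e where "e = Max {d. d < D \<and> (\<exists>x\<in>\<Gamma>. q d x \<noteq> 0)}"
  have fin: "finite {d. d < D \<and> (\<exists>x\<in>\<Gamma>. q d x \<noteq> 0)}" by simp
  have e: "e \<in> {d. d < D \<and> (\<exists>x\<in>\<Gamma>. q d x \<noteq> 0)}"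
    unfolding e_def by (rule Max_in[OF fin]) (use d in auto)
  have max: "q d' y = 0" if "d' < D" "e < d'" "y \<in> \<Gamma>" for d' y
    using Max_ge[OF fin, of d'] that unfolding e_def by fastforce
  have "(\<Sum>d\<le>e. q d y * u y ^ d) = 0" if "y \<in> \<Gamma>" for y
  proof -
    have "(\<Sum>d\<le>e. q d y * u y ^ d) = (\<Sum>d<D. q d y * u y ^ d)"
      using e max that by (intro sum.mono_neutral_left) auto
    then show ?thesis using q(2) that by simp
  qed
  then have "dependent S u e"
    unfolding dependent_def using q(1) e by auto
  then show False using assms e by simp
qed

text \<open>Subtracting the relation from its translate by \<open>c\<close> replaces the leading
  coefficient by \<open>r D (x + c) - r D x\<close>, whose degree bound is smaller. For a suitable
  \<open>c\<close> this is again nontrivial, as long as the leading coefficient is not constant on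
  \<Gamma>.\<close>

lemma constant_lead:
  fixes u :: "'g \<Rightarrow> 'a::field"
  assumes S: "\<And>w. w \<in> S \<Longrightarrow> additive w" and u: "additive u"
    and r: "\<And>d. r d \<in> polyfuns S" and nz: "\<exists>x\<in>\<Gamma>. r D x \<noteq> 0"
    and rel: "\<And>x. x \<in> \<Gamma> \<Longrightarrow> (\<Sum>d\<le>D. r d x * u x ^ d) = 0"
    and deg: "pdeg S n (r D)"
  shows "\<exists>r. (\<forall>d. r d \<in> polyfuns S) \<and> r D 0 \<noteq> 0 \<and> (\<forall>x\<in>\<Gamma>. r D x = r D 0) \<and>
     (\<forall>x\<in>\<Gamma>. (\<Sum>d\<le>D. r d x * u x ^ d) = 0)"
  using r nz rel deg
proof (induction n arbitrary: r)
  case 0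
  obtain k where "r D = (\<lambda>_. k)" using pdeg_0[OF 0(4)] by (rule exE)
  then show ?case using 0 by (intro exI[of _ r]) auto
next
  case (Suc n)
  show ?case
  proof (cases "\<forall>c\<in>\<Gamma>. \<forall>x\<in>\<Gamma>. r D (x + c) = r D x")
    case True
    then have "\<forall>c\<in>\<Gamma>. r D c = r D 0" using zero_mem by force
    then show ?thesis using Suc.prems by (intro exI[of _ r]) auto
  next
    case False
    then obtain c x0 where c: "c \<in> \<Gamma>" "x0 \<in> \<Gamma>" "r D (x0 + c) \<noteq> r D x0" by auto
    define C where "C d x = (\<Sum>e\<le>D. of_nat (e choose d) * r e (x + c) * u c ^ (e - d))" for d x
    have CD: "C D x = r D (x + c)" for x
    proof -
      have "C D x = (\<Sum>e\<in>{D}. of_nat (e choose D) * r e (x + c) * u c ^ (e - D))"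
        unfolding C_def by (intro sum.mono_neutral_right) (auto simp: binomial_eq_0)
      then show ?thesis by simp
    qed
    show ?thesis
    proof (rule Suc.IH[of "\<lambda>d x. C d x - r d x"])
      show "(\<lambda>x. C d x - r d x) \<in> polyfuns S" for d
      proof -
        have "(\<lambda>x. u c ^ (e - d) * (of_nat (e choose d) * r e (x + c))) \<in> polyfuns S" for e
          using Suc.prems(1) S by (intro polyfuns_scale polyfuns_translate) auto
        then have "(\<lambda>x. C d x) \<in> polyfuns S"
          unfolding C_def by (intro polyfuns_sum) (simp add: mult_ac)
        then show ?thesis using Suc.prems(1) by (intro polyfuns_diff) auto
      qed
      show "\<exists>x\<in>\<Gamma>. C D x - r D x \<noteq> 0" using c CD by auto
      show "pdeg S n (\<lambda>x. C D x - r D x)"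
        unfolding CD using Suc.prems(4) S by (intro pdeg_difference) auto
      fix x assume x: "x \<in> \<Gamma>"
      have "(\<Sum>d\<le>D. C d x * u x ^ d) = (\<Sum>e\<le>D. r e (x + c) * (u x + u c) ^ e)"
        unfolding C_def by (rule power_add_regroup[symmetric])
      also have "\<dots> = 0"
        using Suc.prems(3)[OF add_mem[OF x c(1)]] u by (simp add: additive.add)
      finally show "(\<Sum>d\<le>D. (C d x - r d x) * u x ^ d) = 0"
        unfolding left_diff_distrib sum_subtractf using Suc.prems(3)[OF x] by simp
    qed
  qed
qed

text \<open>A nontrivial relation of least degree in \<open>u\<close>, normalised by
  \<open>constant_lead\<close>: its leading coefficient becomes invertible, as division with
  remainder requires. The degree is positive, since a relation of degree 0 says that its only
  coefficient vanishes.\<close>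

lemma minimal_dependence:
  fixes u :: "'g \<Rightarrow> 'a::field"
  assumes S: "\<And>w. w \<in> S \<Longrightarrow> additive w" and u: "additive u" and dep: "dependent S u D'"
  obtains D r where "D > 0" "indep_below S u D" "\<forall>d. r d \<in> polyfuns S" "r D 0 \<noteq> 0"
    "\<forall>x\<in>\<Gamma>. r D x = r D 0" "\<forall>x\<in>\<Gamma>. (\<Sum>d\<le>D. r d x * u x ^ d) = 0"
proof -
  define D where "D = (LEAST D. dependent S u D)"
  have D: "dependent S u D" unfolding D_def by (rule LeastI[of _ D']) (rule dep)
  have "indep_below S u D"
    by (rule indep_below_if_not_dependent) (use not_less_Least D_def in auto)
  moreover have "D > 0"
  proof (rule ccontr)
    assume "\<not> D > 0"
    then show False using D unfolding dependent_def by auto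
  qed
  moreover obtain r where r: "\<forall>d. r d \<in> polyfuns S" "\<exists>x\<in>\<Gamma>. r D x \<noteq> 0"
    "\<forall>x\<in>\<Gamma>. (\<Sum>d\<le>D. r d x * u x ^ d) = 0"
    using D unfolding dependent_def by auto
  moreover obtain n where "pdeg S n (r D)" using r(1) unfolding polyfuns_def by auto
  ultimately obtain r' where "\<forall>d. r' d \<in> polyfuns S" "r' D 0 \<noteq> 0" "\<forall>x\<in>\<Gamma>. r' D x = r' D 0"
    "\<forall>x\<in>\<Gamma>. (\<Sum>d\<le>D. r' d x * u x ^ d) = 0"
    using constant_lead[OF S u, of S r D n] by auto
  then show ?thesis using that[of D r'] \<open>D > 0\<close> \<open>indep_below S u D\<close> by auto
qed

end

section \<open>Additive polynomials in a set of maps\<close>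

text \<open>The p-polynomials in the members of \<open>S\<close>, which in characteristic 0 are just
  their linear combinations.\<close>

inductive_set frobenius_span :: "('g \<Rightarrow> 'a::field) set \<Rightarrow> ('g \<Rightarrow> 'a) set" for S where
  zero: "(\<lambda>_. 0) \<in> frobenius_span S"
| step: "u \<in> S \<Longrightarrow> e \<in> char_powers TYPE('a) \<Longrightarrow> h \<in> frobenius_span S \<Longrightarrow>
    (\<lambda>x. c * u x ^ e + h x) \<in> frobenius_span S"

lemma frobenius_span_mono: "h \<in> frobenius_span S \<Longrightarrow> S \<subseteq> S' \<Longrightarrow> h \<in> frobenius_span S'"
  by (induction rule: frobenius_span.induct) (auto intro: frobenius_span.intros)

lemma frobenius_span_sum:
  fixes u :: "'g \<Rightarrow> 'a::field"
  assumes "finite E" "u \<in> S" "h \<in> frobenius_span S"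
    and "\<And>e. e \<in> E \<Longrightarrow> c e \<noteq> 0 \<Longrightarrow> e \<in> char_powers TYPE('a)"
  shows "(\<lambda>x. h x + (\<Sum>e\<in>E. c e * u x ^ e)) \<in> frobenius_span S"
  using assms(1,4)
proof (induction E)
  case empty
  then show ?case using assms(3) by simp
next
  case (insert e E)
  then have IH: "(\<lambda>x. h x + (\<Sum>e\<in>E. c e * u x ^ e)) \<in> frobenius_span S" by auto
  show ?case
  proof (cases "c e = 0")
    case True
    then show ?thesis using IH insert by simp
  next
    case False
    then have "(\<lambda>x. c e * u x ^ e + (h x + (\<Sum>e\<in>E. c e * u x ^ e))) \<in> frobenius_span S"
      using insert.prems by (intro frobenius_span.step[OF assms(2) _ IH]) auto
    then show ?thesis using insert by (simp add: algebra_simps)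
  qed
qed

lemma additive_frobenius_span:
  assumes "\<And>u. u \<in> S \<Longrightarrow> additive u" "h \<in> frobenius_span S"
  shows "additive h"
  using assms(2)
proof (induction rule: frobenius_span.induct)
  case (step u e h c)
  then show ?case using assms(1)[OF step(1)] char_powers_add[OF step(2)]
    by (simp add: additive_def algebra_simps)
qed (simp add: additive_def)

lemma pdeg_insert_expansion:
  assumes "pdeg (insert u S) n h"
  shows "\<exists>q. (\<forall>d. q d \<in> polyfuns S) \<and> (\<forall>x. h x = (\<Sum>d<Suc n. q d x * u x ^ d))"
  using assms
proof (induction rule: pdeg.induct)
  case (const c)
  then show ?case by (intro exI[of _ "\<lambda>_ _. c"]) (simp add: polyfuns_const)
next
  case (mult v n r)
  then obtain q where q: "\<forall>d. q d \<in> polyfuns S" "\<forall>x. r x = (\<Sum>d<Suc n. q d x * u x ^ d)"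
    by auto
  show ?case
  proof (cases "v = u")
    case True
    define q' where "q' d = (if d = 0 then (\<lambda>_. 0) else q (d - 1))" for d
    have "v x * r x = (\<Sum>d<Suc (Suc n). q' d x * u x ^ d)" for x
      unfolding sum.lessThan_Suc_shift[of _ "Suc n"] using q(2) True
      by (simp add: q'_def sum_distrib_left mult_ac del: sum.lessThan_Suc)
    moreover have "\<forall>d. q' d \<in> polyfuns S" using q(1) by (simp add: q'_def polyfuns_const)
    ultimately show ?thesis by auto
  next
    case False
    define q' where "q' d = (if d = Suc n then (\<lambda>_. 0) else (\<lambda>x. v x * q d x))" for d
    have "v x * r x = (\<Sum>d<Suc (Suc n). q' d x * u x ^ d)" for x
      using q(2) by (simp add: q'_def sum_distrib_left mult_ac algebra_simps)
    moreover have "\<forall>d. q' d \<in> polyfuns S"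
      using q(1) mult(1) False by (simp add: q'_def polyfuns_const polyfuns_mult polyfuns_base)
    ultimately show ?thesis by auto
  qed
next
  case (add n r s)
  then obtain q q' where q: "\<forall>d. q d \<in> polyfuns S" "\<forall>x. r x = (\<Sum>d<Suc n. q d x * u x ^ d)"
    "\<forall>d. q' d \<in> polyfuns S" "\<forall>x. s x = (\<Sum>d<Suc n. q' d x * u x ^ d)"
    by auto
  have "r x + s x = (\<Sum>d<Suc n. (q d x + q' d x) * u x ^ d)" for x
    using q by (simp add: sum.distrib distrib_right del: sum.lessThan_Suc)
  then show ?case using q by (intro exI[of _ "\<lambda>d x. q d x + q' d x"]) (auto simp: polyfuns_add)
next
  case (Suc n r)
  then obtain q where q: "\<forall>d. q d \<in> polyfuns S" "\<forall>x. r x = (\<Sum>d<Suc n. q d x * u x ^ d)"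
    by auto
  then show ?case
    by (intro exI[of _ "q(Suc n := (\<lambda>_. 0))"]) (auto simp: polyfuns_const intro!: sum.cong)
qed

text \<open>Division with remainder by the relation, whose leading coefficient on \<Gamma> is the
  nonzero constant \<open>k\<close>.\<close>

lemma pdeg_insert_reduction:
  fixes u :: "'g \<Rightarrow> 'a::field"
  assumes D: "D > 0" and r: "\<forall>d. r d \<in> polyfuns S" and k: "k \<noteq> 0" "\<forall>x\<in>\<Gamma>. r D x = k"
    and rel: "\<forall>x\<in>\<Gamma>. (\<Sum>d\<le>D. r d x * u x ^ d) = 0"
    and "pdeg (insert u S) n h"
  shows "\<exists>q. (\<forall>d. q d \<in> polyfuns S) \<and> (\<forall>x\<in>\<Gamma>. h x = (\<Sum>d<D. q d x * u x ^ d))"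
  using assms(6)
proof (induction rule: pdeg.induct)
  case (const c)
  show ?case
  proof (intro exI[of _ "\<lambda>d _. if d = 0 then c else 0"] conjI allI ballI)
    show "(\<lambda>_. if d = 0 then c else 0) \<in> polyfuns S" for d by (rule polyfuns_const)
    show "c = (\<Sum>d<D. (if d = 0 then c else 0) * u x ^ d)" for x
      using D by (simp add: if_distrib[of "\<lambda>y. y * _"] cong: if_cong)
  qed
next
  case (mult v n h)
  then obtain q where q: "\<forall>d. q d \<in> polyfuns S" "\<forall>x\<in>\<Gamma>. h x = (\<Sum>d<D. q d x * u x ^ d)"
    by auto
  show ?case
  proof (cases "v = u")
    case False
    then show ?thesis using q mult(1)
      by (intro exI[of _ "\<lambda>d x. v x * q d x"])
        (auto simp: polyfuns_mult polyfuns_base sum_distrib_left mult_ac)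
  next
    case True
    obtain m where m: "D = Suc m" using D by (cases D) auto
    \<comment> \<open>Multiplication by \<open>u\<close> shifts the coefficients by one. The
      overflow \<open>q m x * u x ^ D\<close> is rewritten by solving the relation for
      \<open>u x ^ D\<close>.\<close>
    define q' where "q' d = (\<lambda>x. (if d = 0 then (\<lambda>_. 0) else q (d - 1)) x - (1 / k) * (q m x * r d x))" for d
    have "q' d \<in> polyfuns S" for d
      unfolding q'_def using q(1) r
      by (intro polyfuns_diff polyfuns_scale polyfuns_mult) (auto simp: polyfuns_const)
    moreover have "v x * h x = (\<Sum>d<D. q' d x * u x ^ d)" if x: "x \<in> \<Gamma>" for x
    proof -
      have "(\<Sum>d\<le>D. r d x * u x ^ d) = (\<Sum>d<D. r d x * u x ^ d) + k * u x ^ D"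
        using k(2) x by (simp add: lessThan_Suc_atMost[symmetric])
      then have "u x ^ D = - (1 / k) * (\<Sum>d<D. r d x * u x ^ d)"
        using rel x k(1) by (simp add: field_simps eq_neg_iff_add_eq_0)
      then have "q m x * u x ^ D = (\<Sum>d<D. - (1 / k) * (q m x * r d x) * u x ^ d)"
        by (simp add: sum_distrib_left sum_divide_distrib sum_negf mult_ac)
      moreover have "(\<Sum>d<D. (if d = 0 then (\<lambda>_. 0) else q (d - 1)) x * u x ^ d) = (\<Sum>d<m. q d x * u x ^ Suc d)"
        unfolding m sum.lessThan_Suc_shift by simp
      moreover have "v x * h x = (\<Sum>d<m. q d x * u x ^ Suc d) + q m x * u x ^ D"
        using q(2) x True unfolding m by (simp add: sum_distrib_left distrib_left mult_ac)
      ultimately show ?thesis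
        unfolding q'_def left_diff_distrib sum_subtractf by (simp add: sum_negf)
    qed
    ultimately show ?thesis by auto
  qed
next
  case (add n g h)
  then obtain q q' where q: "\<forall>d. q d \<in> polyfuns S" "\<forall>x\<in>\<Gamma>. g x = (\<Sum>d<D. q d x * u x ^ d)"
    "\<forall>d. q' d \<in> polyfuns S" "\<forall>x\<in>\<Gamma>. h x = (\<Sum>d<D. q' d x * u x ^ d)"
    by auto
  have "g x + h x = (\<Sum>d<D. (q d x + q' d x) * u x ^ d)" if "x \<in> \<Gamma>" for x
    using q that by (simp add: sum.distrib distrib_right)
  then show ?case using q by (intro exI[of _ "\<lambda>d x. q d x + q' d x"]) (auto simp: polyfuns_add)
qed simp

context additive_subset
begin

text \<open>Induction on \<open>S\<close>. Written in powers of \<open>u\<close> that are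
  independent on \<Gamma>, \<open>h\<close> falls under \<open>additive_polynomial\<close>, which
  leaves constants at additive exponents and, in degree 0, an additive polynomial function over the
  smaller set. If \<open>u\<close> satisfies no relation, any degree bound serves.\<close>

lemma additive_polyfun_in_frobenius_span:
  fixes h :: "'g \<Rightarrow> 'a::field"
  assumes "finite S" "\<And>u. u \<in> S \<Longrightarrow> additive u" "h \<in> polyfuns S"
    and "\<And>x y. x \<in> \<Gamma> \<Longrightarrow> y \<in> \<Gamma> \<Longrightarrow> h (x + y) = h x + h y"
  shows "\<exists>h'\<in>frobenius_span S. \<forall>x\<in>\<Gamma>. h x = h' x"
  using assms
proof (induction S arbitrary: h)
  case empty
  then obtain n where "pdeg {} n h" unfolding polyfuns_def by auto
  then have "\<exists>k. h = (\<lambda>_. k)"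
    by (induction rule: pdeg.induct) auto
  then obtain k where k: "h = (\<lambda>_. k)" by auto
  have "k + k = k" using empty(3)[of 0 0] zero_mem k by simp
  then have "k = 0" using add_cancel_left_right by blast
  then show ?case using k by (intro bexI[OF _ frobenius_span.zero]) simp
next
  case (insert u S)
  have S: "\<And>w. w \<in> S \<Longrightarrow> additive w" and u: "additive u" using insert.prems by auto
  obtain n where n: "pdeg (insert u S) n h" using insert.prems(2) unfolding polyfuns_def by auto
  obtain D q where D: "D > 0" "indep_below S u D" and q: "\<forall>d. q d \<in> polyfuns S"
    "\<forall>x\<in>\<Gamma>. h x = (\<Sum>d<D. q d x * u x ^ d)"
  proof (cases "\<exists>D. dependent S u D")
    case True
    then obtain D' where "dependent S u D'" by auto
    then obtain D r where D: "D > 0" "indep_below S u D" "\<forall>d. r d \<in> polyfuns S" "r D 0 \<noteq> 0"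
      "\<forall>x\<in>\<Gamma>. r D x = r D 0" "\<forall>x\<in>\<Gamma>. (\<Sum>d\<le>D. r d x * u x ^ d) = 0"
      using minimal_dependence[OF S u, of S D'] by auto
    show ?thesis
      using pdeg_insert_reduction[OF D(1,3-6) n] that D(1,2) by auto
  next
    case False
    then have "indep_below S u (Suc n)" by (intro indep_below_if_not_dependent) auto
    then show ?thesis using pdeg_insert_expansion[OF n] that[of "Suc n"] by auto
  qed
  \<comment> \<open>A zero coefficient is put in degree \<open>D\<close>, because
    \<open>additive_polynomial\<close> asks for a top coefficient that is constant on
    \<Gamma>.\<close>
  define r where "r = q(D := (\<lambda>_. 0))"
  have r: "r d \<in> polyfuns S" for d using q(1) by (simp add: r_def polyfuns_const)
  have top: "r D x = r D 0" for x by (simp add: r_def)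
  have hr: "h x = (\<Sum>d\<le>D. r d x * u x ^ d)" if "x \<in> \<Gamma>" for x
  proof -
    have "(\<Sum>d\<le>D. r d x * u x ^ d) = (\<Sum>d<D. r d x * u x ^ d)"
      by (simp add: lessThan_Suc_atMost[symmetric] r_def)
    also have "\<dots> = (\<Sum>d<D. q d x * u x ^ d)" by (intro sum.cong) (auto simp: r_def)
    finally show ?thesis using q(2) that by simp
  qed
  note P = additive_polynomial[OF S u D(2,1) r top hr insert.prems(3)]
  obtain h0 where h0: "h0 \<in> frobenius_span S" "\<forall>x\<in>\<Gamma>. r 0 x = h0 x"
    using insert.IH[OF S r P(3)] by auto
  have "(\<lambda>x. h0 x + (\<Sum>e\<in>{0<..D}. r e 0 * u x ^ e)) \<in> frobenius_span (insert u S)"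
    by (rule frobenius_span_sum) (use P(2) frobenius_span_mono[OF h0(1), of "insert u S"] in auto)
  moreover have "\<forall>x\<in>\<Gamma>. h x = h0 x + (\<Sum>e\<in>{0<..D}. r e 0 * u x ^ e)"
    using P(4) h0(2) by simp
  ultimately show ?case by auto
qed

text \<open>Artin's theorem on algebraically dependent additive maps, relative to \<open>\<Gamma>\<close>.\<close>

lemma dependent_imp_additive_relation:
  fixes u :: "'g \<Rightarrow> 'a::field"
  assumes "finite S" "\<And>w. w \<in> S \<Longrightarrow> additive w" "additive u" "dependent S u D'"
  obtains D b h where "D \<in> char_powers TYPE('a)" "b D \<noteq> 0" "h \<in> frobenius_span S"
    "\<forall>e\<in>{0<..D}. b e \<noteq> 0 \<longrightarrow> e \<in> char_powers TYPE('a)"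
    "\<forall>x\<in>\<Gamma>. h x + (\<Sum>e\<in>{0<..D}. b e * u x ^ e) = 0"
proof -
  obtain D r where D: "D > 0" "indep_below S u D" "\<forall>d. r d \<in> polyfuns S" "r D 0 \<noteq> 0"
    "\<forall>x\<in>\<Gamma>. r D x = r D 0" "\<forall>x\<in>\<Gamma>. (\<Sum>d\<le>D. r d x * u x ^ d) = 0"
    by (rule minimal_dependence[OF assms(2-4)])
  \<comment> \<open>The zero function is additive, so the relation itself is an instance of
    \<open>additive_polynomial\<close>.\<close>
  have "0 = (\<Sum>d\<le>D. r d x * u x ^ d)" if "x \<in> \<Gamma>" for x using D(6) that by simp
  note P = additive_polynomial[OF assms(2,3) D(2,1) D(3)[rule_format] D(5)[rule_format] this]
  obtain h where h: "h \<in> frobenius_span S" "\<forall>x\<in>\<Gamma>. r 0 x = h x"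
    using additive_polyfun_in_frobenius_span[OF assms(1,2) D(3)[rule_format] P(3)] by auto
  show ?thesis
    by (rule that[of D "\<lambda>e. r e 0" h]) (use P(2) P(4)[symmetric] h D in auto)
qed

end

section \<open>Uniform algebraicity from saturation\<close>

text \<open>Names for the elements of \<open>fun_closure I f (insert x A)\<close>, with
  \<open>x\<close> read into \<open>Var 0\<close>.\<close>

inductive_set word_trms :: "'i set \<Rightarrow> 'a set \<Rightarrow> ('i, 'a) trm set" for I A where
  Var: "Var 0 \<in> word_trms I A"
| Par: "a \<in> A \<Longrightarrow> Par a \<in> word_trms I A"
| Fn: "i \<in> I \<Longrightarrow> t \<in> word_trms I A \<Longrightarrow> Fn i t \<in> word_trms I A"

inductive_set poly_trms :: "'i set \<Rightarrow> 'a set \<Rightarrow> ('i, 'a) trm set" for I A where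
  word: "t \<in> word_trms I A \<Longrightarrow> t \<in> poly_trms I A"
| Plus: "s \<in> poly_trms I A \<Longrightarrow> t \<in> poly_trms I A \<Longrightarrow> Plus s t \<in> poly_trms I A"
| Times: "s \<in> poly_trms I A \<Longrightarrow> t \<in> poly_trms I A \<Longrightarrow> Times s t \<in> poly_trms I A"

lemma word_trms_syntax:
  "t \<in> word_trms I A \<Longrightarrow> trm_syms t \<subseteq> I \<and> trm_pars t \<subseteq> A \<and> trm_vars t \<subseteq> {0}"
  by (induction rule: word_trms.induct) auto

lemma poly_trms_syntax:
  "t \<in> poly_trms I A \<Longrightarrow> trm_syms t \<subseteq> I \<and> trm_pars t \<subseteq> A \<and> trm_vars t \<subseteq> {0}"
  by (induction rule: poly_trms.induct) (auto dest: word_trms_syntax)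

lemma trm_val_cong: "(\<And>n. n \<in> trm_vars t \<Longrightarrow> v n = w n) \<Longrightarrow> trm_val f v t = trm_val f w t"
  by (induction t) auto

lemma poly_trms_val: "t \<in> poly_trms I A \<Longrightarrow> trm_val f v t = trm_val f (\<lambda>_. v 0) t"
  by (rule trm_val_cong) (auto dest: poly_trms_syntax)

abbreviation at_point :: "('i \<Rightarrow> 'a::field \<Rightarrow> 'a) \<Rightarrow> 'a \<Rightarrow> ('i, 'a) trm \<Rightarrow> 'a" where
  "at_point f x t \<equiv> trm_val f (\<lambda>_. x) t"

lemma fun_closure_imp_word_trm:
  "y \<in> fun_closure I f (insert x A) \<Longrightarrow> \<exists>t\<in>word_trms I A. at_point f x t = y"
proof (induction rule: fun_closure.induct)
  case (base y)
  then show ?case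
  proof (cases "y = x")
    case True
    then show ?thesis by (intro bexI[OF _ word_trms.Var]) simp
  next
    case False
    then show ?thesis using base by (intro bexI[OF _ word_trms.Par[of y]]) auto
  qed
next
  case (step i y)
  then obtain t where "t \<in> word_trms I A" "at_point f x t = y" by auto
  then show ?case using step(1) by (intro bexI[OF _ word_trms.Fn[of i I t]]) auto
qed

text \<open>Terms have no symbols for 0, 1 and negation, so these enter as parameters; the values of
  polynomial terms then form a subring.\<close>

locale unital_parameters =
  fixes I :: "'i set" and f :: "'i \<Rightarrow> 'a::field \<Rightarrow> 'a" and A :: "'a set"
  assumes unit_params: "0 \<in> A" "1 \<in> A" "- 1 \<in> A"
begin

definition poly_vals :: "'a \<Rightarrow> 'a set" where
  "poly_vals x = at_point f x ` poly_trms I A"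

lemma poly_vals_const: "a \<in> A \<Longrightarrow> a \<in> poly_vals x"
  unfolding poly_vals_def
  by (rule image_eqI[of _ _ "Par a"]) (auto intro: poly_trms.word word_trms.Par)

lemma poly_vals_add:
  assumes "a \<in> poly_vals x" "b \<in> poly_vals x"
  shows "a + b \<in> poly_vals x"
proof -
  obtain s t where "s \<in> poly_trms I A" "a = at_point f x s" "t \<in> poly_trms I A" "b = at_point f x t"
    using assms unfolding poly_vals_def by auto
  then show ?thesis unfolding poly_vals_def
    by (intro image_eqI[of _ _ "Plus s t"]) (auto intro: poly_trms.Plus)
qed

lemma poly_vals_mult:
  assumes "a \<in> poly_vals x" "b \<in> poly_vals x"
  shows "a * b \<in> poly_vals x"
proof -
  obtain s t where "s \<in> poly_trms I A" "a = at_point f x s" "t \<in> poly_trms I A" "b = at_point f x t"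
    using assms unfolding poly_vals_def by auto
  then show ?thesis unfolding poly_vals_def
    by (intro image_eqI[of _ _ "Times s t"]) (auto intro: poly_trms.Times)
qed

lemma generate_field_imp_fraction:
  assumes "z \<in> generate_field ring_of_type_algebra (fun_closure I f (insert x A))"
  shows "\<exists>a\<in>poly_vals x. \<exists>b\<in>poly_vals x. b \<noteq> 0 \<and> z = a / b"
  using assms
proof (induction rule: generate_field.induct)
  case one
  then show ?case using poly_vals_const[OF unit_params(2), of x]
    by (intro bexI[of _ 1]) (auto simp: ring_of_type_algebra_def)
next
  case (incl h)
  then obtain t where "t \<in> word_trms I A" "at_point f x t = h"
    using fun_closure_imp_word_trm by metis
  then have "h \<in> poly_vals x" unfolding poly_vals_def by (auto intro: poly_trms.word)
  then show ?case using poly_vals_const[OF unit_params(2), of x]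
    by (intro bexI[of _ h] bexI[of _ 1]) auto
next
  case (a_inv h)
  then obtain a b where ab: "a \<in> poly_vals x" "b \<in> poly_vals x" "b \<noteq> 0" "h = a / b" by auto
  interpret R: ring "ring_of_type_algebra :: 'a ring" by (rule ring_from_type_algebra)
  have "\<ominus>\<^bsub>ring_of_type_algebra\<^esub> h = - h"
    by (rule R.minus_equality) (auto simp: ring_of_type_algebra_def)
  then show ?case using ab poly_vals_mult[OF poly_vals_const[OF unit_params(3)] ab(1)]
    by (intro bexI[of _ "- 1 * a"] bexI[of _ b]) auto
next
  case (m_inv h)
  then obtain a b where ab: "a \<in> poly_vals x" "b \<in> poly_vals x" "b \<noteq> 0" "h = a / b" by auto
  interpret R: cring "ring_of_type_algebra :: 'a ring" by (rule cring_from_type_algebra)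
  have "h \<noteq> 0" using m_inv by (simp add: ring_of_type_algebra_def)
  then have "inv\<^bsub>ring_of_type_algebra\<^esub> h = 1 / h"
    by (intro R.comm_inv_char) (auto simp: ring_of_type_algebra_def)
  then show ?case using ab \<open>h \<noteq> 0\<close> by (intro bexI[of _ b] bexI[of _ a]) auto
next
  case (eng_add h1 h2)
  then obtain a b c d where ab: "a \<in> poly_vals x" "b \<in> poly_vals x" "b \<noteq> 0" "h1 = a / b"
    and cd: "c \<in> poly_vals x" "d \<in> poly_vals x" "d \<noteq> 0" "h2 = c / d" by auto
  have "h1 + h2 = (a * d + c * b) / (b * d)" using ab cd by (simp add: field_simps)
  then show ?case using ab cd
    by (intro bexI[of _ "a * d + c * b"] bexI[of _ "b * d"])
      (auto simp: ring_of_type_algebra_def intro: poly_vals_add poly_vals_mult)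
next
  case (eng_mult h1 h2)
  then obtain a b c d where ab: "a \<in> poly_vals x" "b \<in> poly_vals x" "b \<noteq> 0" "h1 = a / b"
    and cd: "c \<in> poly_vals x" "d \<in> poly_vals x" "d \<noteq> 0" "h2 = c / d" by auto
  then show ?case
    by (intro bexI[of _ "a * c"] bexI[of _ "b * d"])
      (auto simp: ring_of_type_algebra_def intro: poly_vals_mult)
qed

lemma clear_denominators:
  assumes "\<And>n. coeff p n \<in> generate_field ring_of_type_algebra (fun_closure I f (insert x A))"
  shows "\<exists>b\<in>poly_vals x. b \<noteq> 0 \<and> (\<forall>n. coeff (smult b p) n \<in> poly_vals x)"
  using assms
proof (induction p)
  case 0
  then show ?case using poly_vals_const unit_params by (intro bexI[of _ 1]) auto
next
  case (pCons a p)
  have "coeff p n \<in> generate_field ring_of_type_algebra (fun_closure I f (insert x A))" for n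
    using pCons.prems[of "Suc n"] by simp
  then obtain b where b: "b \<in> poly_vals x" "b \<noteq> 0" "\<And>n. coeff (smult b p) n \<in> poly_vals x"
    using pCons.IH by auto
  obtain c d where cd: "c \<in> poly_vals x" "d \<in> poly_vals x" "d \<noteq> 0" "a = c / d"
    using generate_field_imp_fraction[of a x] pCons.prems[of 0] by auto
  have "coeff (smult (b * d) (pCons a p)) n \<in> poly_vals x" for n
  proof (cases n)
    case 0
    then show ?thesis using b cd poly_vals_mult by simp
  next
    case (Suc m)
    then show ?thesis using poly_vals_mult[OF cd(2) b(3)[of m]] by (simp add: mult_ac)
  qed
  then show ?case using b cd poly_vals_mult by (intro bexI[of _ "b * d"]) auto
qed

text \<open>The polynomial has coefficients in the field itself and \<open>to_ac\<close> is an
  embedding, so the root relation descends. Clearing denominators turns its coefficients into values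
  of polynomial terms.\<close>

lemma algebraic_imp_poly_trms:
  assumes "to_ac y \<in> field_alg_closure (fun_closure I f (insert x A))"
  shows "\<exists>ts. set ts \<subseteq> poly_trms I A \<and> (\<exists>t\<in>set ts. at_point f x t \<noteq> 0) \<and>
    (\<Sum>d<length ts. at_point f x (ts ! d) * y ^ d) = 0"
proof -
  obtain p where p: "p \<noteq> 0" "poly (map_poly to_ac p) (to_ac y) = 0"
    "\<And>n. coeff p n \<in> generate_field ring_of_type_algebra (fun_closure I f (insert x A))"
    using assms unfolding field_alg_closure_def by auto
  have "poly (map_poly to_ac p) (to_ac y) = to_ac (poly p y)"
    by (simp add: poly_altdef degree_map_poly coeff_map_poly to_ac_sum)
  then have root: "poly p y = 0" using p by simp
  obtain b where b: "b \<noteq> 0" "\<And>n. coeff (smult b p) n \<in> poly_vals x"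
    using clear_denominators[OF p(3)] by auto
  define q where "q = smult b p"
  have "\<exists>t\<in>poly_trms I A. at_point f x t = coeff q n" for n
    using b(2)[of n] unfolding poly_vals_def q_def by auto
  then obtain t where t: "\<And>n. t n \<in> poly_trms I A" "\<And>n. at_point f x (t n) = coeff q n"
    by metis
  have "q \<noteq> 0" using p b by (simp add: q_def)
  have root_q: "poly q y = 0" using root by (simp add: q_def)
  define ts where "ts = map t [0..<Suc (degree q)]"
  have "(\<Sum>d<length ts. at_point f x (ts ! d) * y ^ d) = (\<Sum>d\<le>degree q. coeff q d * y ^ d)"
    unfolding ts_def by (simp add: t(2) lessThan_Suc_atMost[symmetric] del: upt_Suc)
  then have "(\<Sum>d<length ts. at_point f x (ts ! d) * y ^ d) = 0"
    using root_q by (simp add: poly_altdef)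
  moreover have "t (degree q) \<in> set ts" unfolding ts_def by auto
  moreover have "at_point f x (t (degree q)) \<noteq> 0" using t(2) \<open>q \<noteq> 0\<close> by simp
  moreover have "set ts \<subseteq> poly_trms I A" using t(1) unfolding ts_def by auto
  ultimately show ?thesis by blast
qed

end

section \<open>Formulas about polynomial relations\<close>

primrec horner_trm :: "('i, 'a::field) trm list \<Rightarrow> ('i, 'a) trm" where
  "horner_trm [] = Par 0"
| "horner_trm (t # ts) = Plus t (Times (Var 1) (horner_trm ts))"

primrec all_zero_fm :: "('i, 'a::field) trm list \<Rightarrow> ('i, 'a) fm" where
  "all_zero_fm [] = Eq (Par 0) (Par 0)"
| "all_zero_fm (t # ts) = Conj (Eq t (Par 0)) (all_zero_fm ts)"

lemma trm_val_horner:
  "trm_val f v (horner_trm ts) = (\<Sum>d<length ts. trm_val f v (ts ! d) * v 1 ^ d)"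
  by (induction ts) (simp_all add: sum.lessThan_Suc_shift sum_distrib_left mult_ac del: sum.lessThan_Suc)

lemma sat_all_zero: "sat f v (all_zero_fm ts) \<longleftrightarrow> (\<forall>t\<in>set ts. trm_val f v t = 0)"
  by (induction ts) auto

lemma horner_trm_syntax:
  assumes "0 \<in> A" "set ts \<subseteq> poly_trms I A"
  shows "trm_syms (horner_trm ts) \<subseteq> I \<and> trm_pars (horner_trm ts) \<subseteq> A \<and> trm_vars (horner_trm ts) \<subseteq> {0, 1}"
  using assms
proof (induction ts)
  case (Cons t ts)
  then show ?case using poly_trms_syntax[of t I A] by auto
qed simp

lemma all_zero_fm_syntax:
  assumes "0 \<in> A" "set ts \<subseteq> poly_trms I A"
  shows "fm_syms (all_zero_fm ts) \<subseteq> I \<and> fm_pars (all_zero_fm ts) \<subseteq> A \<and> free_vars (all_zero_fm ts) \<subseteq> {0}"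
  using assms
proof (induction ts)
  case (Cons t ts)
  then show ?case using poly_trms_syntax[of t I A] by auto
qed simp

text \<open>With \<open>\<phi>\<close> the graph of \<open>\<sigma>\<close>: \<open>ts\<close> evaluated at \<open>x\<close> is not a nonzero polynomial with root \<open>\<sigma> x\<close>.\<close>

definition no_relation_fm :: "('i, 'a::field) fm \<Rightarrow> ('i, 'a) trm list \<Rightarrow> ('i, 'a) fm" where
  "no_relation_fm \<phi> ts = Exi 1 (Conj \<phi>
     (Neg (Conj (Neg (all_zero_fm ts)) (Eq (horner_trm ts) (Par 0)))))"

lemma sat_no_relation_fm:
  assumes "\<And>v. sat f v \<phi> \<longleftrightarrow> v 1 = \<sigma> (v 0)" "set ts \<subseteq> poly_trms I A"
  shows "sat f (\<lambda>_. x) (no_relation_fm \<phi> ts) \<longleftrightarrow>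
    \<not> ((\<exists>t\<in>set ts. at_point f x t \<noteq> 0) \<and> (\<Sum>d<length ts. at_point f x (ts ! d) * \<sigma> x ^ d) = 0)"
proof -
  have val: "trm_val f ((\<lambda>_. x)(1 := c)) t = at_point f x t" if "t \<in> set ts" for t c
    using poly_trms_val[of t I A f "(\<lambda>_. x)(1 := c)"] that assms(2) by auto
  have "(\<Sum>d<length ts. trm_val f ((\<lambda>_. x)(1 := c)) (ts ! d) * c ^ d) = (\<Sum>d<length ts. at_point f x (ts ! d) * c ^ d)" for c
    by (intro sum.cong) (use val in auto)
  then show ?thesis
    unfolding no_relation_fm_def using val by (simp add: assms(1) sat_all_zero trm_val_horner)
qed

lemma finite_trm_pars: "finite (trm_pars t)" by (induction t) auto

lemma finite_fm_pars: "finite (fm_pars \<phi>)" by (induction \<phi>) (auto simp: finite_trm_pars)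

text \<open>With \<open>A\<close> containing the parameters of the graph, \<open>\<sigma> x\<close>
  lies in \<open>acl\<close> of \<open>A\<close> and \<open>x\<close>, and so satisfies a nontrivial
  relation over words in \<open>x\<close>. Hence the formulas denying these relations have no common
  solution, and by saturation finitely many of them already have none.\<close>

lemma definable_fun_uniformly_algebraic:
  fixes f :: "'i \<Rightarrow> 'a::field \<Rightarrow> 'a" and \<kappa> :: "'k rel"
  assumes "Card_order \<kappa>" "natLeq \<le>o \<kappa>" "saturated \<kappa> I f"
    and acl: "\<And>A. acl I f A \<subseteq> {x. to_ac x \<in> field_alg_closure (fun_closure I f A)}"
    and "definable_fun I f \<sigma>"
  obtains A \<T> where "finite \<T>" "\<forall>ts\<in>\<T>. set ts \<subseteq> poly_trms I A"
    "\<forall>x. \<exists>ts\<in>\<T>. (\<exists>t\<in>set ts. at_point f x t \<noteq> 0) \<and> (\<Sum>d<length ts. at_point f x (ts ! d) * \<sigma> x ^ d) = 0"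
proof -
  obtain \<phi> where \<phi>: "fm_syms \<phi> \<subseteq> I" "free_vars \<phi> \<subseteq> {..<2}" "\<And>v. sat f v \<phi> \<longleftrightarrow> v 1 = \<sigma> (v 0)"
    using assms(5) unfolding definable_fun_def formulas_def by auto
  define A where "A = fm_pars \<phi> \<union> {0, 1, - 1}"
  interpret unital_parameters I f A by standard (auto simp: A_def)
  have finA: "finite A" by (simp add: A_def finite_fm_pars)
  have "finite A \<Longrightarrow> |A| <o natLeq" by (simp add: finite_iff_ordLess_natLeq)
  then have cardA: "|A| <o \<kappa>" using finA assms(2) ordLess_ordLeq_trans by blast
  have alg: "to_ac (\<sigma> x) \<in> field_alg_closure (fun_closure I f (insert x A))" for x
  proof -
    \<comment> \<open>\<open>acl\<close> wants a formula in variable 0, while the graph has its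
      value in variable 1. The candidate is copied to variable 1 before variable 0 is rebound to
      \<open>x\<close>.\<close>
    define \<psi> where "\<psi> = Exi 1 (Conj (Eq (Var 1) (Var 0)) (Exi 0 (Conj (Eq (Var 0) (Par x)) \<phi>)))"
    have "{y. sat f (\<lambda>_. y) \<psi>} = {\<sigma> x}"
      unfolding \<psi>_def by (auto simp: \<phi>(3))
    moreover have "\<psi> \<in> formulas I (insert x A) 1"
      using \<phi> unfolding \<psi>_def formulas_def A_def by (auto simp: lessThan_Suc numeral_2_eq_2)
    ultimately have "\<sigma> x \<in> acl I f (insert x A)"
      unfolding acl_def by (intro UnionI[of "{\<sigma> x}"]) auto
    then show ?thesis using acl by auto
  qed
  define \<Gamma> where "\<Gamma> = no_relation_fm \<phi> ` {ts. set ts \<subseteq> poly_trms I A}"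
  have "\<Gamma> \<subseteq> formulas I A 1"
  proof
    fix \<theta> assume "\<theta> \<in> \<Gamma>"
    then obtain ts where ts: "set ts \<subseteq> poly_trms I A" "\<theta> = no_relation_fm \<phi> ts"
      unfolding \<Gamma>_def by auto
    have "fm_pars \<phi> \<subseteq> A" by (auto simp: A_def)
    then show "\<theta> \<in> formulas I A 1"
      using horner_trm_syntax[OF unit_params(1) ts(1)] all_zero_fm_syntax[OF unit_params(1) ts(1)] \<phi>(1,2) unit_params(1)
      unfolding ts(2) no_relation_fm_def formulas_def by (auto simp: lessThan_Suc numeral_2_eq_2)
  qed
  moreover have "\<not> (\<exists>x. \<forall>\<theta>\<in>\<Gamma>. sat f (\<lambda>_. x) \<theta>)"
  proof
    assume "\<exists>x. \<forall>\<theta>\<in>\<Gamma>. sat f (\<lambda>_. x) \<theta>"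
    then obtain x where x: "\<forall>\<theta>\<in>\<Gamma>. sat f (\<lambda>_. x) \<theta>" by auto
    obtain ts where ts: "set ts \<subseteq> poly_trms I A" "\<exists>t\<in>set ts. at_point f x t \<noteq> 0"
      "(\<Sum>d<length ts. at_point f x (ts ! d) * \<sigma> x ^ d) = 0"
      using algebraic_imp_poly_trms[OF alg, of x] by auto
    have "sat f (\<lambda>_. x) (no_relation_fm \<phi> ts)" using x ts(1) unfolding \<Gamma>_def by auto
    then show False using sat_no_relation_fm[OF \<phi>(3) ts(1)] ts(2,3) by simp
  qed
  ultimately have "\<not> (\<forall>\<Delta>. finite \<Delta> \<and> \<Delta> \<subseteq> \<Gamma> \<longrightarrow> (\<exists>x. \<forall>\<theta>\<in>\<Delta>. sat f (\<lambda>_. x) \<theta>))"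
    using assms(3)[unfolded saturated_def, rule_format, of A \<Gamma>] cardA by argo
  then obtain \<Delta> where \<Delta>: "finite \<Delta>" "\<Delta> \<subseteq> \<Gamma>" "\<not> (\<exists>x. \<forall>\<theta>\<in>\<Delta>. sat f (\<lambda>_. x) \<theta>)"
    by auto
  obtain \<T> where \<T>: "\<T> \<subseteq> {ts. set ts \<subseteq> poly_trms I A}" "finite \<T>" "\<Delta> = no_relation_fm \<phi> ` \<T>"
    using finite_subset_image[OF \<Delta>(1)] \<Delta>(2) unfolding \<Gamma>_def by metis
  show ?thesis
  proof (rule that[of \<T> A])
    show "finite \<T>" by fact
    show sub: "\<forall>ts\<in>\<T>. set ts \<subseteq> poly_trms I A" using \<T>(1) by auto
    show "\<forall>x. \<exists>ts\<in>\<T>. (\<exists>t\<in>set ts. at_point f x t \<noteq> 0) \<and> (\<Sum>d<length ts. at_point f x (ts ! d) * \<sigma> x ^ d) = 0"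
    proof
      fix x
      obtain ts where "ts \<in> \<T>" "\<not> sat f (\<lambda>_. x) (no_relation_fm \<phi> ts)" using \<Delta>(3) \<T>(3) by auto
      then show "\<exists>ts\<in>\<T>. (\<exists>t\<in>set ts. at_point f x t \<noteq> 0) \<and> (\<Sum>d<length ts. at_point f x (ts ! d) * \<sigma> x ^ d) = 0"
        using sat_no_relation_fm[OF \<phi>(3), of ts I A x] sub by auto
    qed
  qed
qed

section \<open>Finite fields\<close>

lemma finite_field_generator:
  assumes "finite (UNIV :: 'a::field set)"
  shows "\<exists>g::'a. g \<noteq> 0 \<and> (\<forall>x. x \<noteq> 0 \<longrightarrow> (\<exists>n. x = g ^ n))"
proof -
  interpret R: field "ring_of_type_algebra :: 'a ring" by (rule field_from_type_algebra)
  let ?R = "ring_of_type_algebra :: 'a ring"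
  have simps: "carrier ?R = UNIV" "\<zero>\<^bsub>?R\<^esub> = 0" "\<one>\<^bsub>?R\<^esub> = 1" "\<And>x y. x \<otimes>\<^bsub>?R\<^esub> y = x * y"
    by (simp_all add: ring_of_type_algebra_def)
  have pow: "x [^]\<^bsub>?R\<^esub> n = x ^ n" for x and n :: nat
    by (induction n) (simp_all add: simps mult.commute)
  have "finite (carrier ?R)" using assms simps by simp
  then obtain g where g: "g \<in> carrier (mult_of ?R)" "carrier (mult_of ?R) = {g [^]\<^bsub>?R\<^esub> i | i::nat. i \<in> UNIV}"
    using R.finite_field_mult_group_has_gen by auto
  have "\<exists>n. x = g ^ n" if "x \<noteq> 0" for x
  proof -
    have "x \<in> carrier (mult_of ?R)" using that by (simp add: simps)
    then show ?thesis unfolding g(2) using pow by auto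
  qed
  moreover have "g \<noteq> 0" using g(1) by (simp add: simps)
  ultimately show ?thesis by auto
qed

text \<open>\<sigma> is a power map at a generator, hence at all nonzero elements. The exponent is
  taken with \<open>0 < m < q\<close>, positivity taking care of the point 0. By additivity
  \<open>(x + 1) ^ m - x ^ m - 1\<close> has all \<open>q\<close> elements as roots, so it is the
  zero polynomial and the inner binomial coefficients vanish in the field.\<close>

lemma finite_field_endo_is_power:
  fixes \<sigma> :: "'a::field \<Rightarrow> 'a"
  assumes fin: "finite (UNIV :: 'a set)"
    and add: "\<And>x y. \<sigma> (x + y) = \<sigma> x + \<sigma> y" and mult: "\<And>x y. \<sigma> (x * y) = \<sigma> x * \<sigma> y"
    and one: "\<sigma> 1 = 1"
  shows "\<exists>e\<in>char_powers TYPE('a). \<forall>x. \<sigma> x = x ^ e"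
proof -
  have zero: "\<sigma> 0 = 0" by (rule additive.zero) (simp add: additive_def add)
  obtain g :: 'a where g: "g \<noteq> 0" "\<And>x. x \<noteq> 0 \<Longrightarrow> \<exists>n. x = g ^ n"
    using finite_field_generator[OF fin] by auto
  have "\<sigma> g * \<sigma> (inverse g) = 1" using mult[of g "inverse g"] g one by simp
  then have "\<sigma> g \<noteq> 0" by auto
  then obtain n where n: "\<sigma> g = g ^ n" using g(2) by auto
  define q where "q = card (UNIV :: 'a set)"
  have q: "q \<ge> 2"
  proof -
    have "card {0, 1 :: 'a} \<le> q" unfolding q_def by (intro card_mono fin) auto
    then show ?thesis by simp
  qed
  have unit: "x ^ (q - 1) = 1" if "x \<noteq> 0" for x :: 'a
  proof -
    have "x ^ (q - 1) * \<Prod>(UNIV - {0}) = (\<Prod>y\<in>UNIV - {0}. x * y)"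
      using fin by (simp add: prod.distrib q_def)
    also have "\<dots> = \<Prod>(UNIV - {0})"
      by (rule prod.reindex_bij_witness[of _ "\<lambda>y. y / x" "\<lambda>y. x * y"]) (use that in auto)
    finally show ?thesis using fin by simp
  qed
  \<comment> \<open>a positive representative of \<open>n\<close> modulo \<open>q - 1\<close>\<close>
  define m where "m = (if n mod (q - 1) = 0 then q - 1 else n mod (q - 1))"
  have "n mod (q - 1) < q - 1" using q by (intro mod_less_divisor) simp
  then have "m \<le> q - 1"
    unfolding m_def by (cases "n mod (q - 1) = 0") (simp_all only: if_True if_False order.refl less_imp_le simp_thms)
  moreover have "0 < m" using q by (auto simp: m_def)
  ultimately have m: "0 < m" "m < q" using q by linarith+
  have "g ^ n = g ^ (n mod (q - 1))"
  proof -
    have "g ^ n = g ^ ((q - 1) * (n div (q - 1)) + n mod (q - 1))" by simp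
    also have "\<dots> = (g ^ (q - 1)) ^ (n div (q - 1)) * g ^ (n mod (q - 1))"
      by (simp only: power_add power_mult)
    finally show ?thesis using unit[OF g(1)] by simp
  qed
  then have sg: "\<sigma> g = g ^ m" using n unit[OF g(1)] by (auto simp: m_def)
  have pow: "\<sigma> (x ^ k) = \<sigma> x ^ k" for x k by (induction k) (auto simp: one mult)
  have \<sigma>: "\<sigma> x = x ^ m" for x
  proof (cases "x = 0")
    case True
    then show ?thesis using m zero by simp
  next
    case False
    then obtain k where "x = g ^ k" using g(2) by auto
    then show ?thesis using pow sg by (simp add: power_mult[symmetric] mult.commute)
  qed
  have "m \<in> char_powers TYPE('a)"
  proof (rule char_powersI[OF m(1)])
    fix d assume d: "0 < d" "d < m"
    define P where "P = (\<Sum>d\<in>{0<..<m}. monom (of_nat (m choose d)) d :: 'a poly)"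
    have "poly P x = 0" for x
    proof -
      have "{..m} = insert 0 (insert m {0<..<m})" using m by auto
      then have "(x + 1) ^ m = poly P x + x ^ m + 1"
        using m by (subst binomial_ring) (simp add: P_def poly_sum poly_monom)
      then show ?thesis using add[of x 1] by (simp add: \<sigma>)
    qed
    moreover have "degree P \<le> m"
      unfolding P_def by (intro degree_sum_le) (auto intro: order.trans[OF degree_monom_le])
    ultimately have "P = 0"
      using card_poly_roots_bound[of P] m(2) unfolding q_def by (cases "P = 0") auto
    then have "coeff P d = 0" by simp
    then show "of_nat (m choose d) = (0::'a)"
      using d by (simp add: P_def coeff_sum)
  qed
  then show ?thesis using \<sigma> by auto
qed

section \<open>Pfaffian families and their words\<close>

inductive_set words :: "'i set \<Rightarrow> ('i \<Rightarrow> 'a \<Rightarrow> 'a) \<Rightarrow> ('a \<Rightarrow> 'a) set" for I f where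
  ident: "(\<lambda>x. x) \<in> words I f"
| step: "i \<in> I \<Longrightarrow> w \<in> words I f \<Longrightarrow> (\<lambda>x. f i (w x)) \<in> words I f"

lemma additive_words:
  assumes "\<And>i. i \<in> I \<Longrightarrow> additive (f i)"
  shows "w \<in> words I f \<Longrightarrow> additive w"
  by (induction rule: words.induct) (use assms in \<open>simp_all add: additive_def\<close>)

lemma word_trms_at_point:
  "t \<in> word_trms I A \<Longrightarrow> (\<lambda>x. at_point f x t) \<in> words I f \<or> (\<exists>c. \<forall>x. at_point f x t = c)"
proof (induction rule: word_trms.induct)
  case (Fn i t)
  then show ?case
  proof (elim disjE)
    assume "(\<lambda>x. at_point f x t) \<in> words I f"
    from words.step[OF Fn(1) this] show ?thesis by simp
  next
    assume "\<exists>c. \<forall>x. at_point f x t = c"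
    then show ?thesis by auto
  qed
qed (auto intro: words.ident)

lemma poly_trms_at_point:
  "t \<in> poly_trms I A \<Longrightarrow> \<exists>S. finite S \<and> S \<subseteq> words I f \<and> (\<lambda>x. at_point f x t) \<in> polyfuns S"
proof (induction rule: poly_trms.induct)
  case (word t)
  then consider "(\<lambda>x. at_point f x t) \<in> words I f" | c where "(\<lambda>x. at_point f x t) = (\<lambda>_. c)"
    using word_trms_at_point[of t I A f] by auto
  then show ?case
  proof cases
    case 1
    then show ?thesis
      by (intro exI[of _ "{\<lambda>x. at_point f x t}"]) (auto intro: polyfuns_base)
  next
    case 2
    then show ?thesis by (intro exI[of _ "{}"]) (simp add: polyfuns_const)
  qed
next
  case (Plus s t)
  then obtain S T where "finite S" "S \<subseteq> words I f" "(\<lambda>x. at_point f x s) \<in> polyfuns S"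
    "finite T" "T \<subseteq> words I f" "(\<lambda>x. at_point f x t) \<in> polyfuns T" by auto
  then show ?case
    by (intro exI[of _ "S \<union> T"]) (auto intro!: polyfuns_add elim: polyfuns_mono)
next
  case (Times s t)
  then obtain S T where "finite S" "S \<subseteq> words I f" "(\<lambda>x. at_point f x s) \<in> polyfuns S"
    "finite T" "T \<subseteq> words I f" "(\<lambda>x. at_point f x t) \<in> polyfuns T" by auto
  then show ?case
    by (intro exI[of _ "S \<union> T"]) (auto intro!: polyfuns_mult elim: polyfuns_mono)
qed

section \<open>Spans and the independent part of a family\<close>

lemma K_span_base: "j \<in> J \<Longrightarrow> f j \<in> K_span J f"
  unfolding K_span_def by (intro CollectI exI[of _ "\<lambda>_. 1"] exI[of _ "{j}"]) auto

lemma K_span_mono: "J \<subseteq> J' \<Longrightarrow> K_span J f \<subseteq> K_span J' f"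
  unfolding K_span_def by auto

lemma K_span_add_scale:
  assumes "g \<in> K_span J f" "h \<in> K_span J f"
  shows "(\<lambda>x. a * g x + h x) \<in> K_span J f"
proof -
  obtain c S where S: "finite S" "S \<subseteq> J" "g = (\<lambda>x. \<Sum>j\<in>S. c j * f j x)"
    using assms(1) unfolding K_span_def by auto
  obtain d T where T: "finite T" "T \<subseteq> J" "h = (\<lambda>x. \<Sum>j\<in>T. d j * f j x)"
    using assms(2) unfolding K_span_def by auto
  define e where "e j = (if j \<in> S then a * c j else 0) + (if j \<in> T then d j else 0)" for j
  have "a * g x + h x = (\<Sum>j\<in>S \<union> T. e j * f j x)" for x
  proof -
    have "(\<Sum>j\<in>S \<union> T. (if j \<in> S then a * c j else 0) * f j x) = (\<Sum>j\<in>S. a * c j * f j x)"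
      using S(1) T(1) by (intro sum.mono_neutral_cong_right) auto
    moreover have "(\<Sum>j\<in>S \<union> T. (if j \<in> T then d j else 0) * f j x) = (\<Sum>j\<in>T. d j * f j x)"
      using S(1) T(1) by (intro sum.mono_neutral_cong_right) auto
    moreover have "(\<Sum>j\<in>S \<union> T. e j * f j x) = (\<Sum>j\<in>S \<union> T. (if j \<in> S then a * c j else 0) * f j x)
        + (\<Sum>j\<in>S \<union> T. (if j \<in> T then d j else 0) * f j x)"
      unfolding e_def distrib_right sum.distrib ..
    ultimately show ?thesis
      unfolding S(3) T(3) by (simp add: sum_distrib_left mult.assoc)
  qed
  then show ?thesis unfolding K_span_def using S T
    by (intro CollectI exI[of _ e] exI[of _ "S \<union> T"]) auto
qed

lemma K_span_sum:
  assumes "finite S" "\<And>s. s \<in> S \<Longrightarrow> g s \<in> K_span J f"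
  shows "(\<lambda>x. \<Sum>s\<in>S. c s * g s x) \<in> K_span J f"
  using assms
proof (induction S)
  case empty
  show ?case unfolding K_span_def by (intro CollectI exI[of _ "\<lambda>_. 0"] exI[of _ "{}"]) auto
next
  case (insert s S)
  then have "(\<lambda>x. c s * g s x + (\<Sum>s\<in>S. c s * g s x)) \<in> K_span J f"
    by (intro K_span_add_scale) auto
  then show ?case using insert by simp
qed

text \<open>A dependent \<open>f i\<close> is a combination of earlier members, to which induction
  applies. The bound \<open>l \<le> i\<close> is recorded for the sake of the index bounds in the
  Pfaffian condition.\<close>

lemma in_K_span_independent_part:
  fixes I :: "'i::wellorder set" and f :: "'i \<Rightarrow> 'a::field \<Rightarrow> 'a"
  assumes "i \<in> I"
  shows "f i \<in> K_span {l \<in> independent_part I f. l \<le> i} f"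
  using assms
proof (induction i rule: less_induct)
  case (less i)
  show ?case
  proof (cases "i \<in> independent_part I f")
    case True
    then show ?thesis by (intro K_span_base) auto
  next
    case False
    then have "f i \<in> K_span {j \<in> I. j < i} f"
      using less.prems unfolding independent_part_def by auto
    then obtain c S where S: "finite S" "S \<subseteq> {j \<in> I. j < i}" "f i = (\<lambda>x. \<Sum>j\<in>S. c j * f j x)"
      unfolding K_span_def by auto
    have "f j \<in> K_span {l \<in> independent_part I f. l \<le> i} f" if "j \<in> S" for j
    proof -
      have "f j \<in> K_span {l \<in> independent_part I f. l \<le> j} f"
        using that S(2) by (intro less.IH) auto
      moreover have "{l \<in> independent_part I f. l \<le> j} \<subseteq> {l \<in> independent_part I f. l \<le> i}"
        using that S(2) by auto
      ultimately show ?thesis using K_span_mono by blast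
    qed
    then have "(\<lambda>x. \<Sum>j\<in>S. c j * f j x) \<in> K_span {l \<in> independent_part I f. l \<le> i} f"
      by (rule K_span_sum[OF S(1)])
    then show ?thesis using S(3) by simp
  qed
qed

text \<open>The expansions over the independent part are substituted into the Pfaffian identity.
  They never raise an index, so the bound by \<open>i\<close> persists.\<close>

lemma pfaffian_coeffs_independent_part:
  fixes I :: "'i::wellorder set" and f :: "'i \<Rightarrow> 'a::field \<Rightarrow> 'a"
  assumes "pfaffian_coeffs I f i a"
  shows "\<exists>b. pfaffian_coeffs (independent_part I f) f i b"
proof -
  define J where "J = independent_part I f"
  define N where "N = {(j, k). a j k \<noteq> 0}"
  have N: "finite N" "\<And>j k. (j, k) \<in> N \<Longrightarrow> j \<in> I \<and> k \<in> I \<and> j \<le> i \<and> k \<le> i"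
    and f_mult: "\<And>x y. f i (x * y) = (\<Sum>(j, k)\<in>N. a j k * f j x * f k y)"
    using assms unfolding pfaffian_coeffs_def N_def by auto
  have "\<forall>j\<in>I. \<exists>c S. finite S \<and> S \<subseteq> {l \<in> J. l \<le> j} \<and> f j = (\<lambda>x. \<Sum>l\<in>S. c l * f l x)"
    using in_K_span_independent_part[of _ I f] unfolding K_span_def J_def by auto
  then obtain c where "\<forall>j\<in>I. \<exists>S. finite S \<and> S \<subseteq> {l \<in> J. l \<le> j} \<and> f j = (\<lambda>x. \<Sum>l\<in>S. c j l * f l x)"
    by (rule bchoice[THEN exE])
  then obtain S where cS: "\<forall>j\<in>I. finite (S j) \<and> S j \<subseteq> {l \<in> J. l \<le> j} \<and> f j = (\<lambda>x. \<Sum>l\<in>S j. c j l * f l x)"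
    by (rule bchoice[THEN exE])
  note S = cS[rule_format, THEN conjunct1] cS[rule_format, THEN conjunct2, THEN conjunct1]
  \<comment> \<open>All indices used to expand the functions that occur; below, \<open>c'\<close>
    pads every expansion by zeros to this common finite set.\<close>
  define T where "T = (\<Union>j\<in>fst ` N \<union> snd ` N. S j)"
  have T_index: "j \<in> I" "j \<le> i" if "j \<in> fst ` N \<union> snd ` N" for j using that N(2) by auto
  have T: "finite T" "\<And>l. l \<in> T \<Longrightarrow> l \<in> J \<and> l \<le> i"
  proof -
    show "finite T" unfolding T_def using N(1) S(1) T_index(1) by (intro finite_UN_I) auto
    fix l assume "l \<in> T"
    then obtain j where "j \<in> fst ` N \<union> snd ` N" "l \<in> S j" unfolding T_def by (rule UN_E)
    then show "l \<in> J \<and> l \<le> i" using S(2)[of j] T_index[of j] by auto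
  qed
  define c' where "c' j l = (if l \<in> S j then c j l else 0)" for j l
  have expand: "f j x = (\<Sum>l\<in>T. c' j l * f l x)" if "j \<in> fst ` N \<union> snd ` N" for j x
  proof -
    have "f j x = (\<Sum>l\<in>S j. c j l * f l x)"
      using cS[rule_format, OF T_index(1)[OF that]] by (elim conjE) (rule fun_cong)
    also have "\<dots> = (\<Sum>l\<in>T. c' j l * f l x)"
      using T(1) that unfolding c'_def T_def by (intro sum.mono_neutral_cong_left) auto
    finally show ?thesis .
  qed
  define b where "b l m = (if l \<in> T \<and> m \<in> T then (\<Sum>(j, k)\<in>N. a j k * c' j l * c' k m) else 0)" for l m
  have supp: "{(l, m). b l m \<noteq> 0} \<subseteq> T \<times> T" unfolding b_def by (auto split: if_splits)
  have "f i (x * y) = (\<Sum>(l, m) | b l m \<noteq> 0. b l m * f l x * f m y)" for x y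
  proof -
    have "f i (x * y) = (\<Sum>(j, k)\<in>N. a j k * (\<Sum>l\<in>T. c' j l * f l x) * (\<Sum>m\<in>T. c' k m * f m y))"
      unfolding f_mult
    proof (intro sum.cong refl, clarify)
      fix j k assume "(j, k) \<in> N"
      then have "j \<in> fst ` N \<union> snd ` N" "k \<in> fst ` N \<union> snd ` N" by force+
      then show "a j k * f j x * f k y = a j k * (\<Sum>l\<in>T. c' j l * f l x) * (\<Sum>m\<in>T. c' k m * f m y)"
        using expand[of j x] expand[of k y] by simp
    qed
    also have "\<dots> = (\<Sum>(j, k)\<in>N. \<Sum>(l, m)\<in>T \<times> T. a j k * c' j l * c' k m * f l x * f m y)"
    proof (intro sum.cong refl, clarify)
      fix j k
      show "a j k * (\<Sum>l\<in>T. c' j l * f l x) * (\<Sum>m\<in>T. c' k m * f m y) =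
        (\<Sum>(l, m)\<in>T \<times> T. a j k * c' j l * c' k m * f l x * f m y)"
      proof -
        have prod: "(\<Sum>l\<in>T. c' j l * f l x) * (\<Sum>m\<in>T. c' k m * f m y) =
          (\<Sum>(l, m)\<in>T \<times> T. (c' j l * f l x) * (c' k m * f m y))"
          unfolding sum_product sum.cartesian_product ..
        have "a j k * (\<Sum>l\<in>T. c' j l * f l x) * (\<Sum>m\<in>T. c' k m * f m y) =
          a j k * (\<Sum>(l, m)\<in>T \<times> T. (c' j l * f l x) * (c' k m * f m y))"
          by (subst mult.assoc, subst prod) (rule refl)
        also have "\<dots> = (\<Sum>(l, m)\<in>T \<times> T. a j k * c' j l * c' k m * f l x * f m y)"
          unfolding sum_distrib_left
        proof (rule sum.cong[OF refl])
          fix p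
          show "a j k * (case p of (l, m) \<Rightarrow> c' j l * f l x * (c' k m * f m y)) =
            (case p of (l, m) \<Rightarrow> a j k * c' j l * c' k m * f l x * f m y)"
            by (cases p) (simp only: prod.case mult_ac)
        qed
        finally show ?thesis .
      qed
    qed
    also have "\<dots> = (\<Sum>p\<in>T \<times> T. \<Sum>(j, k)\<in>N. a j k * c' j (fst p) * c' k (snd p) * f (fst p) x * f (snd p) y)"
      unfolding case_prod_unfold by (rule sum.swap)
    also have "\<dots> = (\<Sum>(l, m)\<in>T \<times> T. b l m * f l x * f m y)"
      by (intro sum.cong refl) (auto simp: b_def sum_distrib_right case_prod_unfold)
    also have "\<dots> = (\<Sum>(l, m) | b l m \<noteq> 0. b l m * f l x * f m y)"
      using T(1) supp by (intro sum.mono_neutral_right) auto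
    finally show ?thesis .
  qed
  moreover have "finite {(l, m). b l m \<noteq> 0}"
    using supp T(1) by (meson finite_SigmaI finite_subset)
  moreover have "\<forall>l m. b l m \<noteq> 0 \<longrightarrow> l \<in> J \<and> m \<in> J \<and> l \<le> i \<and> m \<le> i"
    using supp T(2) by auto
  ultimately show ?thesis unfolding pfaffian_coeffs_def J_def by auto
qed

text \<open>The Pfaffian identity is collected by the second index: the coefficient of
  \<open>f i y\<close> is the value at \<open>x\<close> of the map associated to \<open>f i\<close>,
  and the other terms have smaller index. The finite set \<open>B\<close> depends on neither
  \<open>x\<close> nor \<open>y\<close>.\<close>

lemma pfaffian_coeffs_shift:
  fixes f :: "'i::wellorder \<Rightarrow> 'a::field \<Rightarrow> 'a"
  assumes "pfaffian_coeffs J f i b"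
  obtains B c where "finite B" "B \<subseteq> {k \<in> J. k < i}"
    "\<forall>x y. f i (x * y) - (\<Sum>j | b j i \<noteq> 0. b j i * f j x) * f i y = (\<Sum>k\<in>B. c x k * f k y)"
proof -
  define N where "N = {(j, k). b j k \<noteq> 0}"
  have N: "finite N" "\<And>j k. (j, k) \<in> N \<Longrightarrow> j \<in> J \<and> k \<in> J \<and> j \<le> i \<and> k \<le> i"
    and f_mult: "\<And>x y. f i (x * y) = (\<Sum>(j, k)\<in>N. b j k * f j x * f k y)"
    using assms unfolding pfaffian_coeffs_def N_def by auto
  define c where "c x k = (\<Sum>j\<in>fst ` N. b j k * f j x)" for x k
  have ci: "c x i = (\<Sum>j | b j i \<noteq> 0. b j i * f j x)" for x
    unfolding c_def using N(1) by (intro sum.mono_neutral_right) (force simp: N_def)+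
  have "f i (x * y) - (\<Sum>j | b j i \<noteq> 0. b j i * f j x) * f i y = (\<Sum>k\<in>snd ` N - {i}. c x k * f k y)" for x y
  proof -
    have "f i (x * y) = (\<Sum>(j, k)\<in>fst ` N \<times> insert i (snd ` N). b j k * f j x * f k y)"
      unfolding f_mult using N(1) by (intro sum.mono_neutral_left) (force simp: N_def)+
    also have "\<dots> = (\<Sum>k\<in>insert i (snd ` N). c x k * f k y)"
      unfolding c_def by (subst sum.cartesian_product[symmetric], subst sum.swap) (simp add: sum_distrib_right)
    also have "\<dots> = c x i * f i y + (\<Sum>k\<in>snd ` N - {i}. c x k * f k y)"
      using N(1) by (subst sum.insert_remove) auto
    finally show ?thesis using ci by simp
  qed
  moreover have "snd ` N - {i} \<subseteq> {k \<in> J. k < i}" using N(2) by (force simp: order.strict_iff_order)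
  ultimately show ?thesis using that[of "snd ` N - {i}" c] N(1) by auto
qed

lemma kills_common:
  assumes "finite B" "\<And>k. k \<in> B \<Longrightarrow> g k \<in> annih C"
  shows "\<exists>L. set L \<subseteq> C \<and> (\<forall>k\<in>B. kills L (g k))"
  using assms
proof (induction B)
  case empty
  show ?case by (intro exI[of _ "[]"]) simp
next
  case (insert k B)
  then obtain L where L: "set L \<subseteq> C" "\<forall>k\<in>B. kills L (g k)" by auto
  obtain M where M: "set M \<subseteq> C" "kills M (g k)" using insert.prems unfolding annih_def by auto
  show ?case
    by (intro exI[of _ "L @ M"]) (use L M in \<open>auto intro: kills_append1 kills_append2\<close>)
qed

lemma kills_sum:
  assumes "finite B" "\<And>k. k \<in> B \<Longrightarrow> kills L (g k)"
  shows "kills L (\<lambda>y. \<Sum>k\<in>B. c k * g k y)"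
  using assms
proof (induction B)
  case empty
  show ?case using kills_append1[of "[]" "\<lambda>_. 0" L] by simp
next
  case (insert k B)
  then have "kills L (\<lambda>y. c k * g k y + (\<Sum>k\<in>B. c k * g k y))"
    by (intro kills_add kills_scale) auto
  then show ?case using insert by simp
qed

lemma pfaffian_in_annih:
  fixes I :: "'i::wellorder set" and f :: "'i \<Rightarrow> 'a::field \<Rightarrow> 'a"
  assumes "K_pfaffian I f" "associated_endos I f \<subseteq> C" "i \<in> I"
  shows "f i \<in> annih C"
  using assms(3)
proof (induction i rule: less_induct)
  case (less i)
  define J where "J = independent_part I f"
  have "J \<subseteq> I" by (auto simp: J_def independent_part_def)
  show ?case
  proof (cases "i \<in> J")
    case False
    then have "f i \<in> K_span {j \<in> I. j < i} f"
      using less.prems unfolding J_def independent_part_def by auto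
    then obtain c S where S: "finite S" "S \<subseteq> {j \<in> I. j < i}" "f i = (\<lambda>x. \<Sum>j\<in>S. c j * f j x)"
      unfolding K_span_def by auto
    have "(\<lambda>x. \<Sum>j\<in>S. c j * f j x) \<in> annih C"
      by (rule annih_sum) (use S(1,2) less.IH in auto)
    then show ?thesis using S(3) by simp
  next
    case True
    obtain a where "pfaffian_coeffs I f i a" using assms(1) less.prems unfolding K_pfaffian_def by auto
    then obtain b where b: "pfaffian_coeffs J f i b"
      using pfaffian_coeffs_independent_part[of I f i a] unfolding J_def by auto
    define \<tau> where "\<tau> x = (\<Sum>j | b j i \<noteq> 0. b j i * f j x)" for x
    have "\<tau> \<in> associated_endos I f"
      unfolding associated_endos_def Let_def J_def[symmetric] \<tau>_def using True b by auto
    then have \<tau>: "\<tau> \<in> C" using assms(2) by auto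
    obtain B c where B: "finite B" "B \<subseteq> {k \<in> J. k < i}"
      "\<forall>x y. f i (x * y) - \<tau> x * f i y = (\<Sum>k\<in>B. c x k * f k y)"
      using b unfolding \<tau>_def by (rule pfaffian_coeffs_shift)
    have "f k \<in> annih C" if "k \<in> B" for k using that B(2) \<open>J \<subseteq> I\<close> by (intro less.IH) auto
    \<comment> \<open>One list serves all of \<open>B\<close>, hence all \<open>x\<close>, since
      only the coefficients \<open>c x k\<close> vary with \<open>x\<close>.\<close>
    then obtain L where L: "set L \<subseteq> C" "\<forall>k\<in>B. kills L (f k)" using kills_common[OF B(1)] by metis
    have "kills (\<tau> # L) (f i)"
      using L(2) unfolding kills.simps B(3)[rule_format] by (intro allI kills_sum[OF B(1)]) auto
    then show ?thesis unfolding annih_def using \<tau> L(1) by (intro CollectI exI[of _ "\<tau> # L"]) auto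
  qed
qed

section \<open>From a finite cover to one relation on a coset\<close>

text \<open>\<open>\<Gamma>\<close> is the stabilizer of an irreducible component; the last conclusion says that it has finite index.\<close>

lemma finite_cover_coset:
  fixes S :: "('g::ab_group_add \<Rightarrow> 'a::field) set"
  assumes S: "finite S" "\<And>u. u \<in> S \<Longrightarrow> additive u"
    and P: "finite \<T>" "\<And>t. t \<in> \<T> \<Longrightarrow> P t \<in> polyfuns S"
    and cover: "\<And>x. \<exists>t\<in>\<T>. Q t x \<and> P t x = 0"
  obtains \<Gamma> t x0 where "additive_subset \<Gamma>" "t \<in> \<T>" "Q t x0" "\<forall>c\<in>\<Gamma>. P t (x0 + c) = 0"
    "\<forall>v :: 'g \<Rightarrow> 'a. additive v \<longrightarrow> (\<forall>c\<in>\<Gamma>. v c = 0) \<longrightarrow> finite (range v)"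
proof -
  have "\<forall>t\<in>\<T>. \<exists>n. pdeg S n (P t)" using P(2) unfolding polyfuns_def by auto
  then obtain n where n: "\<forall>t\<in>\<T>. pdeg S (n t) (P t)" by (rule bchoice[THEN exE])
  \<comment> \<open>A common degree bound puts all \<open>P t\<close> into one finite-dimensional
    space.\<close>
  define M where "M = (\<Sum>t\<in>\<T>. n t)"
  define V where "V = Collect (pdeg S M)"
  have PV: "P t \<in> V" if "t \<in> \<T>" for t
  proof -
    have "n t \<le> M" unfolding M_def using that P(1) by (intro member_le_sum) auto
    then show ?thesis unfolding V_def using n that pdeg_mono[of S "n t" "P t" M] by auto
  qed
  obtain T where T: "finite T" "V \<subseteq> fun_vs.span T"
    using pdeg_finite_span[OF S(1), of M] unfolding V_def by auto
  obtain m :: "'g set \<Rightarrow> nat" where m: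
    "\<And>A B. A \<in> zero_sets V \<Longrightarrow> B \<in> zero_sets V \<Longrightarrow> A \<subset> B \<Longrightarrow> m A < m B"
    using zero_sets_measure[OF T] by metis
  have trans: "(+) c ` A \<in> zero_sets V" if "A \<in> zero_sets V" for A c
    by (rule zero_sets_translate[OF _ that]) (use pdeg_translate S(2) in \<open>auto simp: V_def\<close>)
  obtain Z where Z: "irreducible_in (zero_sets V) Z" "finite (range (\<lambda>c. (+) c ` Z))"
    by (rule irreducible_with_finite_orbit[of "zero_sets V" m])
      (use zero_sets_Int m UNIV_in_zero_sets trans in auto)
  \<comment> \<open>\<open>Q\<close> is an arbitrary predicate, so \<open>B t\<close> need not be a
    zero set; \<open>Y t\<close> is its closure among the zero sets of \<open>V\<close>. Empty
    \<open>B t\<close> are left out of the cover, so that the piece found contains a point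
    satisfying \<open>Q\<close>.\<close>
  define B where "B t = {x \<in> Z. Q t x \<and> P t x = 0}" for t
  define Y where "Y t = zero_set {g \<in> V. \<forall>x\<in>B t. g x = 0}" for t
  have "Y ` {t \<in> \<T>. B t \<noteq> {}} \<subseteq> zero_sets V" unfolding Y_def zero_sets_def by auto
  moreover have "Z \<subseteq> \<Union>(Y ` {t \<in> \<T>. B t \<noteq> {}})"
  proof
    fix x assume "x \<in> Z"
    obtain t where t: "t \<in> \<T>" "Q t x" "P t x = 0" using cover by auto
    then have "x \<in> B t" using \<open>x \<in> Z\<close> unfolding B_def by auto
    moreover from this have "x \<in> Y t" unfolding Y_def zero_set_def by auto
    ultimately show "x \<in> \<Union>(Y ` {t \<in> \<T>. B t \<noteq> {}})" using t(1) by auto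
  qed
  moreover have "finite (Y ` {t \<in> \<T>. B t \<noteq> {}})" using P(1) by simp
  ultimately obtain A where A: "A \<in> Y ` {t \<in> \<T>. B t \<noteq> {}}" "Z \<subseteq> A"
    using irreducible_inD[OF Z(1)] by metis
  then obtain t where t: "t \<in> \<T>" "B t \<noteq> {}" "Z \<subseteq> Y t" by auto
  then obtain x0 where "x0 \<in> B t" by auto
  then have x0: "x0 \<in> Z" "Q t x0" unfolding B_def by auto
  define \<Gamma> where "\<Gamma> = {c. (+) c ` Z = Z}"
  have "additive_subset \<Gamma>"
  proof
    show "0 \<in> \<Gamma>" unfolding \<Gamma>_def by simp
    fix x y assume "x \<in> \<Gamma>" "y \<in> \<Gamma>"
    then have "(+) x ` ((+) y ` Z) = Z" unfolding \<Gamma>_def by simp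
    then show "x + y \<in> \<Gamma>" unfolding \<Gamma>_def by (simp add: image_image add.assoc)
  qed
  moreover have "P t (x0 + c) = 0" if "c \<in> \<Gamma>" for c
  proof -
    have "c + x0 \<in> Z" using that x0(1) unfolding \<Gamma>_def by auto
    then have "x0 + c \<in> Y t" using t(3) by (auto simp: add.commute)
    \<comment> \<open>\<open>P t\<close> belongs to \<open>V\<close> and vanishes on
      \<open>B t\<close>, hence on the closure \<open>Y t\<close>.\<close>
    then show ?thesis using PV[OF t(1)] unfolding Y_def zero_set_def B_def by auto
  qed
  moreover have "finite (range v)" if v: "additive v" "\<And>c. c \<in> \<Gamma> \<Longrightarrow> v c = 0" for v :: "'g \<Rightarrow> 'a"
  proof (rule finite_subset)
    \<comment> \<open>The value \<open>v c\<close> depends only on the translate of \<open>Z\<close>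
      by \<open>c\<close>: if two translates agree, the shifts differ by an element of \<Gamma>,
      where \<open>v\<close> vanishes. There are finitely many translates.\<close>
    show "finite ((\<lambda>A. v (SOME c. (+) c ` Z = A)) ` range (\<lambda>c. (+) c ` Z))"
      using Z(2) by (rule finite_imageI)
    show "range v \<subseteq> (\<lambda>A. v (SOME c. (+) c ` Z = A)) ` range (\<lambda>c. (+) c ` Z)"
    proof
      fix z assume "z \<in> range v"
      then obtain c where c: "z = v c" by auto
      define d where "d = (SOME d. (+) d ` Z = (+) c ` Z)"
      have d: "(+) d ` Z = (+) c ` Z" unfolding d_def by (rule someI[of _ c]) simp
      have "(+) (c - d) ` Z = (+) (- d) ` ((+) c ` Z)" by (simp add: image_image algebra_simps)
      also have "\<dots> = (+) (- d) ` ((+) d ` Z)" by (simp only: d)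
      also have "\<dots> = Z" by (simp add: image_image)
      finally have "v (c - d) = 0" by (intro v(2)) (simp add: \<Gamma>_def)
      then have "v c = v d" using additive.diff[OF v(1)] by simp
      then show "z \<in> (\<lambda>A. v (SOME c. (+) c ` Z = A)) ` range (\<lambda>c. (+) c ` Z)"
        unfolding c d_def by auto
    qed
  qed
  ultimately show ?thesis by (intro that[of \<Gamma> t x0] ballI allI impI t(1) x0(2)) auto
qed

section \<open>The monoid generated by the associated endomorphisms and Frobenius\<close>

lemma Frob_funpow: "(Frob ^^ j) x = (x :: 'a::field) ^ (CHAR('a) ^ j)"
  by (induction j) (simp_all add: Frob_def power_mult[symmetric] mult.commute)

definition associated_monoid :: "'i::wellorder set \<Rightarrow> ('i \<Rightarrow> 'a::field \<Rightarrow> 'a) \<Rightarrow> ('a \<Rightarrow> 'a) set" where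
  "associated_monoid I f =
     compositions (associated_endos I f \<union> (if CHAR('a) > 0 then {Frob} else {}))"

lemma power_in_associated_monoid:
  fixes f :: "'i::wellorder \<Rightarrow> 'a::field \<Rightarrow> 'a"
  assumes "e \<in> char_powers TYPE('a)"
  shows "(\<lambda>x. x ^ e) \<in> associated_monoid I f"
proof -
  obtain j where j: "e = CHAR('a) ^ j" "CHAR('a) = 0 \<longrightarrow> j = 0"
    using assms unfolding char_powers_def by auto
  have "Frob ^^ j \<in> associated_monoid I f"
  proof (cases "CHAR('a) = 0")
    case True
    then show ?thesis using j id_in_compositions unfolding associated_monoid_def by simp
  next
    case False
    then have "Frob \<in> associated_monoid I f" 
      unfolding associated_monoid_def by (intro generator_in_compositions) simp
    then show ?thesis unfolding associated_monoid_def
      by (induction j) (auto intro: id_in_compositions compositions_comp simp del: if_split)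
  qed
  then show ?thesis unfolding j(1) by (simp add: Frob_funpow[symmetric])
qed

text \<open>The identity and the additive power maps are multiplicative members of the monoid, so a
  single operator kills each of them. Words and their powers follow by composition, and the span by
  linearity.\<close>

lemma frobenius_span_words_in_annih:
  fixes f :: "'i::wellorder \<Rightarrow> 'a::field \<Rightarrow> 'a"
  assumes additive: "\<And>i. i \<in> I \<Longrightarrow> additive (f i)" and pfaffian: "K_pfaffian I f"
    and "S \<subseteq> words I f" "h \<in> frobenius_span S"
  shows "h \<in> annih (associated_monoid I f)"
proof -
  have sub: "associated_endos I f \<subseteq> associated_monoid I f"
    unfolding associated_monoid_def by (auto intro: generator_in_compositions simp del: if_split)
  have comp: "\<tau> \<circ> \<rho> \<in> associated_monoid I f"
    if "\<tau> \<in> associated_monoid I f" "\<rho> \<in> associated_monoid I f" for \<tau> \<rho>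
    using that unfolding associated_monoid_def by (rule compositions_comp)
  have words: "w \<in> annih (associated_monoid I f)" if "w \<in> words I f" for w
    using that
  proof (induction rule: words.induct)
    case ident
    have "id \<in> annih (associated_monoid I f)"
      unfolding associated_monoid_def by (intro annih_multiplicative id_in_compositions) simp
    then show ?case by (simp add: id_def)
  next
    case (step i w)
    then show ?case
      using additive pfaffian_in_annih[OF pfaffian sub] comp
      by (intro annih_comp[of "f i" _ w]) auto
  qed
  show ?thesis using assms(4)
  proof (induction rule: frobenius_span.induct)
    case zero
    show ?case by (simp add: annih_finite_range)
  next
    case (step u e h c)
    have "(\<lambda>x. x ^ e) \<in> annih (associated_monoid I f)"
      by (intro annih_multiplicative power_in_associated_monoid step(2)) (simp add: power_mult_distrib)
    moreover have "additive (\<lambda>x::'a. x ^ e)"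
      by (simp add: additive_def char_powers_add[OF step(2)])
    ultimately have "(\<lambda>x. u x ^ e) \<in> annih (associated_monoid I f)"
      using words assms(3) step(1) comp by (intro annih_comp[of "\<lambda>x. x ^ e" _ u]) auto
    then show ?case using step by (intro annih_add annih_scale)
  qed
qed

theorem theorem3p9:
  fixes f :: "'i::wellorder \<Rightarrow> 'a::field \<Rightarrow> 'a" and I :: "'i set"
    and \<kappa> :: "'k rel" and \<sigma> :: "'a \<Rightarrow> 'a"
  assumes "\<And>i. i \<in> I \<Longrightarrow> additive (f i)"
    and "K_pfaffian I f"
    and "Card_order \<kappa>" and "|f ` I| +c natLeq <o \<kappa>" and "saturated \<kappa> I f"
    and "\<And>A. acl I f A = {x. to_ac x \<in> field_alg_closure (fun_closure I f A)}"
    and "field_endo \<sigma>" and "definable_fun I f \<sigma>"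
  shows "\<exists>j. \<exists>\<tau> \<in> compositions (associated_endos I f \<union> (if CHAR('a) > 0 then {Frob} else {})).
           (CHAR('a) = 0 \<longrightarrow> j = 0) \<and> (Frob ^^ j) \<circ> \<sigma> = \<tau>"
proof -
  have \<sigma>: "\<sigma> (x + y) = \<sigma> x + \<sigma> y" "\<sigma> (x * y) = \<sigma> x * \<sigma> y" "\<sigma> 1 = 1" for x y
    using assms(7) unfolding field_endo_def ring_hom_def by (auto simp: ring_of_type_algebra_def)
  have \<sigma>_additive: "additive \<sigma>" by (simp add: additive_def \<sigma>)
  show ?thesis
  proof (cases "finite (UNIV :: 'a set)")
    case True
    obtain e where e: "e \<in> char_powers TYPE('a)" "\<forall>x. \<sigma> x = x ^ e"
      using finite_field_endo_is_power[OF True \<sigma>] by auto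
    then have "\<sigma> = (\<lambda>x. x ^ e)" by auto
    then have "\<sigma> \<in> associated_monoid I f" using power_in_associated_monoid[OF e(1)] by simp
    then show ?thesis unfolding associated_monoid_def by (intro exI[of _ 0] bexI[of _ \<sigma>]) simp_all
  next
    case False
    have "inj \<sigma>"
    proof (rule injI, rule ccontr)
      fix x y assume "\<sigma> x = \<sigma> y" "x \<noteq> y"
      then have "\<sigma> ((x - y) * inverse (x - y)) = 0"
        using additive.diff[OF \<sigma>_additive] by (simp only: \<sigma>(2)) simp
      then show False using \<open>x \<noteq> y\<close> \<sigma>(3) by simp
    qed
    then have inf: "infinite (range \<sigma>)" using False finite_imageD by blast
    have "natLeq \<le>o |f ` I| +c natLeq" by (rule ordLeq_csum2) (rule natLeq_Card_order)
    then have "natLeq \<le>o \<kappa>" using assms(4) ordLeq_ordLess_trans ordLess_imp_ordLeq by metis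
    moreover have "acl I f A \<subseteq> {x. to_ac x \<in> field_alg_closure (fun_closure I f A)}" for A
      using assms(6) by simp
    ultimately obtain A \<T> where T: "finite \<T>" "\<forall>ts\<in>\<T>. set ts \<subseteq> poly_trms I A"
      "\<forall>x. \<exists>ts\<in>\<T>. (\<exists>t\<in>set ts. at_point f x t \<noteq> 0) \<and> (\<Sum>d<length ts. at_point f x (ts ! d) * \<sigma> x ^ d) = 0"
      by (rule definable_fun_uniformly_algebraic[OF assms(3) _ assms(5) _ assms(8)])
    \<comment> \<open>Coefficients are padded by 0 beyond the list, so that the index
      \<open>length ts\<close> may be included in the sums.\<close>
    define R where "R ts d x = (if d < length ts then at_point f x (ts ! d) else 0)" for ts :: "('i, 'a) trm list" and d x

    have "\<forall>t\<in>\<Union>(set ` \<T>). \<exists>S. finite S \<and> S \<subseteq> words I f \<and> (\<lambda>x. at_point f x t) \<in> polyfuns S"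
    proof
      fix t assume "t \<in> \<Union>(set ` \<T>)"
      then have "t \<in> poly_trms I A" using T(2) by auto
      then show "\<exists>S. finite S \<and> S \<subseteq> words I f \<and> (\<lambda>x. at_point f x t) \<in> polyfuns S"
        by (rule poly_trms_at_point)
    qed
    then obtain W where W: "\<forall>t\<in>\<Union>(set ` \<T>). finite (W t) \<and> W t \<subseteq> words I f \<and> (\<lambda>x. at_point f x t) \<in> polyfuns (W t)"
      by (rule bchoice[THEN exE])
    define S where "S = (\<Union>t\<in>\<Union>(set ` \<T>). W t)"
    have S: "finite S" "S \<subseteq> words I f" unfolding S_def using W T(1) by auto
    have S_additive: "additive u" if "u \<in> S" for u
      using additive_words[of I f u] assms(1) S(2) that by auto
    have R: "R ts d \<in> polyfuns S" if "ts \<in> \<T>" for ts d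
    proof (cases "d < length ts")
      case True
      then have t: "ts ! d \<in> \<Union>(set ` \<T>)" using that by (intro UnionI[of "set ts"]) auto
      then have "(\<lambda>x. at_point f x (ts ! d)) \<in> polyfuns (W (ts ! d))" 
        using W[rule_format, of "ts ! d"] by (simp del: UN_iff Union_iff)
      then have "(\<lambda>x. at_point f x (ts ! d)) \<in> polyfuns S"
        by (rule polyfuns_mono) (use t in \<open>unfold S_def, rule UN_upper\<close>)
      then show ?thesis using True unfolding R_def by simp
    next
      case False
      then have "R ts d = (\<lambda>_. 0)" by (simp add: R_def fun_eq_iff)
      then show ?thesis by (simp add: polyfuns_const)
    qed

    define P where "P ts x = (\<Sum>d\<le>length ts. R ts d x * \<sigma> x ^ d)" for ts x
    \<comment> \<open>Nontriviality is a condition at the point \<open>x\<close>; the coset argument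
      returns a point \<open>x0\<close> at which it holds.\<close>
    define Q where "Q ts x \<longleftrightarrow> (\<exists>d\<le>length ts. R ts d x \<noteq> 0)" for ts x
    have P: "P ts \<in> polyfuns (insert \<sigma> S)" if "ts \<in> \<T>" for ts
      unfolding P_def using polyfuns_mono[OF R[OF that], of "insert \<sigma> S"]
      by (intro polyfuns_sum polyfuns_mult polyfuns_power) (auto intro: polyfuns_base)
    have cover: "\<exists>ts\<in>\<T>. Q ts x \<and> P ts x = 0" for x
    proof -
      obtain ts t where ts: "ts \<in> \<T>" "t \<in> set ts" "at_point f x t \<noteq> 0"
        "(\<Sum>d<length ts. at_point f x (ts ! d) * \<sigma> x ^ d) = 0"
        using T(3)[rule_format, of x] by auto
      obtain d where d: "d < length ts" "t = ts ! d" using ts(2) by (auto simp: in_set_conv_nth)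
      then have "Q ts x" unfolding Q_def R_def using ts(3) by (intro exI[of _ d]) auto
      moreover have "P ts x = (\<Sum>d<length ts. at_point f x (ts ! d) * \<sigma> x ^ d)"
        unfolding P_def lessThan_Suc_atMost[symmetric] by (simp add: R_def)
      ultimately show ?thesis using ts by auto
    qed
    have finS: "finite (insert \<sigma> S)" using S(1) by simp
    obtain \<Gamma> ts x0 where \<Gamma>: "additive_subset \<Gamma>" and ts: "ts \<in> \<T>" "Q ts x0"
      and rel: "\<forall>c\<in>\<Gamma>. P ts (x0 + c) = 0"
      and finite_range: "\<forall>v :: 'a \<Rightarrow> 'a. additive v \<longrightarrow> (\<forall>c\<in>\<Gamma>. v c = 0) \<longrightarrow> finite (range v)"
      by (rule finite_cover_coset[where S = "insert \<sigma> S" and \<T> = \<T> and P = P and Q = Q,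
            OF finS _ T(1) P cover])
        (use S_additive \<sigma>_additive in auto)
    interpret additive_subset \<Gamma> by (rule \<Gamma>)
    define D where "D = length ts"

    \<comment> \<open>The relation recentred at \<open>x0\<close>: \<open>r d c\<close> is the
      coefficient of \<open>\<sigma> c ^ d\<close> in \<open>P ts (x0 + c)\<close>.\<close>
    define r where "r d c = (\<Sum>e\<le>D. of_nat (e choose d) * R ts e (c + x0) * \<sigma> x0 ^ (e - d))" for d c
    have r: "r d \<in> polyfuns S" for d
    proof -
      have "(\<lambda>c. R ts e (c + x0)) \<in> polyfuns S" for e
        by (rule polyfuns_translate[OF S_additive R[OF ts(1)]])
      then show ?thesis unfolding r_def by (intro polyfuns_sum polyfuns_mult polyfuns_const)
    qed
    have r_rel: "(\<Sum>d<Suc D. r d c * \<sigma> c ^ d) = 0" if "c \<in> \<Gamma>" for c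
    proof -
      have "(\<Sum>d\<le>D. r d c * \<sigma> c ^ d) = (\<Sum>e\<le>D. R ts e (c + x0) * (\<sigma> c + \<sigma> x0) ^ e)"
        unfolding r_def by (rule power_add_regroup[symmetric])
      also have "\<dots> = P ts (x0 + c)" unfolding P_def D_def by (simp add: \<sigma> add.commute)
      finally show ?thesis using rel that by (simp only: lessThan_Suc_atMost)
    qed
    \<comment> \<open>In \<open>r m 0\<close> the terms with \<open>e > m\<close> vanish by
      maximality of \<open>m\<close>, and those with \<open>e < m\<close> by the binomial
      coefficient. So \<open>r m 0 = R ts m x0\<close>, and the recentred relation is nontrivial on
      \<Gamma>.\<close>
    define m where "m = Max {d. d \<le> D \<and> R ts d x0 \<noteq> 0}"
    have m: "m \<le> D" "R ts m x0 \<noteq> 0" "\<And>e. e \<le> D \<Longrightarrow> m < e \<Longrightarrow> R ts e x0 = 0"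
    proof -
      have fin: "finite {d. d \<le> D \<and> R ts d x0 \<noteq> 0}" by simp
      have "m \<in> {d. d \<le> D \<and> R ts d x0 \<noteq> 0}"
        unfolding m_def by (rule Max_in[OF fin]) (use ts(2) in \<open>auto simp: Q_def D_def\<close>)
      then show "m \<le> D" "R ts m x0 \<noteq> 0" by auto
      show "R ts e x0 = 0" if "e \<le> D" "m < e" for e
        using Max_ge[OF fin, of e] that unfolding m_def by fastforce
    qed
    have "r m 0 = (\<Sum>e\<in>{m}. of_nat (e choose m) * R ts e (0 + x0) * \<sigma> x0 ^ (e - m))"
      unfolding r_def using m by (intro sum.mono_neutral_right) (auto simp: binomial_eq_0 linorder_neq_iff)
    then have "r m 0 \<noteq> 0" using m(2) by simp
    then have "\<not> indep_below S \<sigma> (Suc D)"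
      using indep_belowD[of S \<sigma> "Suc D" r m 0] r r_rel m(1) zero_mem by auto
    then obtain D' where "dependent S \<sigma> D'"
      using indep_below_if_not_dependent[of "Suc D" S \<sigma>] by auto
    from S(1) S_additive \<sigma>_additive this obtain n b h where n: "n \<in> char_powers TYPE('a)" "b n \<noteq> 0" "h \<in> frobenius_span S"
      and b: "\<forall>e\<in>{0<..n}. b e \<noteq> 0 \<longrightarrow> e \<in> char_powers TYPE('a)"
      and hb: "\<forall>x\<in>\<Gamma>. h x + (\<Sum>e\<in>{0<..n}. b e * \<sigma> x ^ e) = 0"
      by (rule dependent_imp_additive_relation)

    have "b e * (\<sigma> x + \<sigma> y) ^ e = b e * \<sigma> x ^ e + b e * \<sigma> y ^ e" if "e \<in> {0<..n}" for e x y
      using b that char_powers_add[of e "\<sigma> x" "\<sigma> y"] by (cases "b e = 0") (auto simp: algebra_simps)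
    then have "additive (\<lambda>x. h x + (\<Sum>e\<in>{0<..n}. b e * \<sigma> x ^ e))"
      using additive_frobenius_span[OF S_additive n(3)]
      by (simp add: additive_def \<sigma> sum.distrib algebra_simps)
    \<comment> \<open>This additive map vanishes on \<Gamma>, so its range over the whole field is
      finite. As \<open>h\<close> is killed too, so is the part in powers of \<sigma>.\<close>
    then have "finite (range (\<lambda>x. h x + (\<Sum>e\<in>{0<..n}. b e * \<sigma> x ^ e)))"
      using finite_range hb by simp
    then have sum: "(\<lambda>x. h x + (\<Sum>e\<in>{0<..n}. b e * \<sigma> x ^ e)) \<in> annih (associated_monoid I f)"
      by (rule annih_finite_range)
    have "h \<in> annih (associated_monoid I f)"
      by (rule frobenius_span_words_in_annih[OF assms(1,2) S(2) n(3)])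
    from annih_add[OF annih_scale[OF this, of "- 1"] sum]
    have "(\<lambda>x. \<Sum>e\<in>{0<..n}. b e * \<sigma> x ^ e) \<in> annih (associated_monoid I f)" by simp
    moreover obtain j where j: "n = CHAR('a) ^ j" "CHAR('a) = 0 \<longrightarrow> j = 0"
      using n(1) unfolding char_powers_def by auto
    moreover have "n > 0" using j by (cases "CHAR('a) = 0") auto
    ultimately have "(\<lambda>x. \<sigma> x ^ n) \<in> associated_monoid I f"
      using annih_power_sum[where \<sigma> = \<sigma> and E = "{0<..n}" and b = b and D = n] \<sigma>(2) inf n(2) by auto
    moreover have "(Frob ^^ j) \<circ> \<sigma> = (\<lambda>x. \<sigma> x ^ n)" by (simp add: fun_eq_iff Frob_funpow j(1))
    ultimately show ?thesis using j(2) unfolding associated_monoid_def by (intro exI[of _ j] bexI[of _ "\<lambda>x. \<sigma> x ^ n"] conjI)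
  qed
qed

end
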